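(* Let $M=(E,\rho)$ be a binary simple $(n,k,d)$-matroid with no isthmuses. If $\mathcal{Z}(M)$ has height 3, then either $\eta(E)=2$ or $M$ is isomorphic to one of the following matroids: (a) the $(6,3,3)$-matroid (whose lattice of cyclic flats has 4 atoms), namely the column matroid over $\mathbb{F}_2$ of $\begin{pmatrix}1&0&0&1&1&1\\0&1&0&1&0&1\\0&0&1&0&1&1\end{pmatrix}$; (b) the $(7,3,4)$-matroid (with 7 atoms), namely the column matroid over $\mathbb{F}_2$ of the $3\times 7$ matrix whose columns are all nonzero vectors of $\mathbb{F}_2^3$; (c) the $(7,4,3)$-matroid (with 7 atoms), namely the dual of the matroid in (b); (d) the $(8,4,4)$-matroid (with 14 atoms), namely the column matroid over $\mathbb{F}_2$ of $\begin{pmatrix}1&0&0&0&1&0&1&1\\0&1&0&0&1&1&0&1\\0&0&1&0&1&1&1&0\\0&0&0&1&0&1&1&1\end{pmatrix}$.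
   Context: A matroid is binary if representable over $\mathbb{F}_2$; simple means no loops and no parallel elements; an isthmus is an element $e$ with $\rho(E-e)<\rho(E)$. $\eta(X)=|X|-\rho(X)$. An $(n,k,d)$-matroid has $|E|=n$, $\rho(E)=k$ and minimum distance $d=\min\{|X|:X\subseteq E,\ \rho(E-X)<\rho(E)\}$. The dual $M^*$ has rank function $\rho^*(A)=|A|+\rho(E-A)-\rho(E)$. $\mathcal{Z}(M)$ is the lattice (under inclusion) of cyclic flats, i.e. sets $X$ with $\mathrm{cl}(X)=X$ and $\mathrm{cyc}(X)=X$, where $\mathrm{cl}(X)=\{e:\rho(X\cup e)=\rho(X)\}$ and $\mathrm{cyc}(X)=\{e\in X:\rho(X-e)=\rho(X)\}$. "Height 3" means the longest chains in $\mathcal{Z}(M)$ consist of three elements $0_{\mathcal{Z}}\subsetneq Z\subsetneq 1_{\mathcal{Z}}$. *)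

theory Defs
  imports
    "HOL-Library.Z2"
    "Jordan_Normal_Form.DL_Rank"
    "Jordan_Normal_Form.DL_Submatrix"
begin

section \<open>Matroids given by a rank function\<close>

text \<open>
  Only the values of the rank function on subsets of the ground set are meaningful; every notion
  below evaluates it on such subsets only.
\<close>

record 'a rank_space =
  ground :: "'a set"
  rk :: "'a set \<Rightarrow> nat"

definition matroid :: "'a rank_space \<Rightarrow> bool" where
  "matroid M \<longleftrightarrow>
     finite (ground M) \<and>
     (\<forall>X. X \<subseteq> ground M \<longrightarrow> rk M X \<le> card X) \<and>
     (\<forall>X Y. X \<subseteq> Y \<and> Y \<subseteq> ground M \<longrightarrow> rk M X \<le> rk M Y) \<and>
     (\<forall>X Y. X \<subseteq> ground M \<and> Y \<subseteq> ground M \<longrightarrow>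
        rk M (X \<union> Y) + rk M (X \<inter> Y) \<le> rk M X + rk M Y)"

definition matroid_iso :: "'a rank_space \<Rightarrow> 'b rank_space \<Rightarrow> bool" where
  "matroid_iso M N \<longleftrightarrow>
     (\<exists>f. bij_betw f (ground M) (ground N) \<and> (\<forall>X. X \<subseteq> ground M \<longrightarrow> rk N (f ` X) = rk M X))"

text \<open>Natural-number subtraction does not truncate in a matroid: \<^term>\<open>rk M X \<le> card X\<close>.\<close>

definition nullity :: "'a rank_space \<Rightarrow> 'a set \<Rightarrow> nat" where
  "nullity M X = card X - rk M X"

text \<open>Here too there is no truncation in a matroid, where \<open>\<rho>(E) \<le> |A| + \<rho>(E - A)\<close>.\<close>

definition matroid_dual :: "'a rank_space \<Rightarrow> 'a rank_space" where
  "matroid_dual M =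
     \<lparr> ground = ground M,
       rk = (\<lambda>A. card A + rk M (ground M - A) - rk M (ground M)) \<rparr>"

definition loop :: "'a rank_space \<Rightarrow> 'a \<Rightarrow> bool" where
  "loop M e \<longleftrightarrow> e \<in> ground M \<and> rk M {e} = 0"

definition parallel_elements :: "'a rank_space \<Rightarrow> 'a \<Rightarrow> 'a \<Rightarrow> bool" where
  "parallel_elements M e f \<longleftrightarrow>
     e \<in> ground M \<and> f \<in> ground M \<and> e \<noteq> f \<and> \<not> loop M e \<and> \<not> loop M f \<and> rk M {e, f} = 1"

definition simple_matroid :: "'a rank_space \<Rightarrow> bool" where
  "simple_matroid M \<longleftrightarrow> matroid M \<and> (\<forall>e. \<not> loop M e) \<and> (\<forall>e f. \<not> parallel_elements M e f)"

definition isthmus :: "'a rank_space \<Rightarrow> 'a \<Rightarrow> bool" where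
  "isthmus M e \<longleftrightarrow> e \<in> ground M \<and> rk M (ground M - {e}) < rk M (ground M)"

text \<open>
  The set in the minimum is empty exactly for matroids of rank 0; these have no minimum distance,
  and \<^const>\<open>Min\<close> is then an unspecified number.
\<close>

definition min_distance :: "'a rank_space \<Rightarrow> nat" where
  "min_distance M =
     Min {card X | X. X \<subseteq> ground M \<and> rk M (ground M - X) < rk M (ground M)}"

definition nkd_matroid :: "'a rank_space \<Rightarrow> nat \<Rightarrow> nat \<Rightarrow> nat \<Rightarrow> bool" where
  "nkd_matroid M n k d \<longleftrightarrow>
     matroid M \<and> card (ground M) = n \<and> rk M (ground M) = k \<and> min_distance M = d"


section \<open>Cyclic flats\<close>

definition cl :: "'a rank_space \<Rightarrow> 'a set \<Rightarrow> 'a set" where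
  "cl M X = {e \<in> ground M. rk M (X \<union> {e}) = rk M X}"

definition cyc :: "'a rank_space \<Rightarrow> 'a set \<Rightarrow> 'a set" where
  "cyc M X = {e \<in> X. rk M (X - {e}) = rk M X}"

definition cyclic_flats :: "'a rank_space \<Rightarrow> 'a set set" where
  "cyclic_flats M = {X. X \<subseteq> ground M \<and> cl M X = X \<and> cyc M X = X}"

text \<open>The height counts the elements of a longest chain, not its covering steps.\<close>

definition height :: "'a set set \<Rightarrow> nat" where
  "height L = Max {card C | C. subset.chain L C}"

definition atoms :: "'a set set \<Rightarrow> 'a set set" where
  "atoms L =
     (let b = (LEAST X. X \<in> L) in {A \<in> L. b \<subset> A \<and> \<not> (\<exists>B \<in> L. b \<subset> B \<and> B \<subset> A)})"


section \<open>Column matroids and representability\<close>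

text \<open>
  The ground set is the set of column indices, so equal columns give distinct elements. The rank of
  a set of indices is the dimension of the span of the columns with these indices.
\<close>

definition column_matroid :: "'f :: field mat \<Rightarrow> nat rank_space" where
  "column_matroid A =
     \<lparr> ground = {..<dim_col A},
       rk = (\<lambda>X. vec_space.rank (dim_row A) (submatrix A UNIV X)) \<rparr>"

definition representable_over :: "'f :: field itself \<Rightarrow> 'a rank_space \<Rightarrow> bool" where
  "representable_over F M \<longleftrightarrow> (\<exists>A :: 'f mat. matroid_iso M (column_matroid A))"

definition binary_matroid :: "'a rank_space \<Rightarrow> bool" where
  "binary_matroid M \<longleftrightarrow> matroid M \<and> representable_over TYPE(bit) M"


section \<open>The exceptional matroids\<close>

definition matroid_a :: "nat rank_space" where
  "matroid_a = column_matroid (mat_of_rows_list 6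
     [[1, 0, 0, 1, 1, 1],
      [0, 1, 0, 1, 0, 1],
      [0, 0, 1, 0, 1, 1]] :: bit mat)"

text \<open>The columns are the numbers 1 to 7 in binary, least significant digit first.\<close>

definition matroid_b :: "nat rank_space" where
  "matroid_b = column_matroid (mat_of_rows_list 7
     [[1, 0, 1, 0, 1, 0, 1],
      [0, 1, 1, 0, 0, 1, 1],
      [0, 0, 0, 1, 1, 1, 1]] :: bit mat)"

definition matroid_c :: "nat rank_space" where
  "matroid_c = matroid_dual matroid_b"

definition matroid_d :: "nat rank_space" where
  "matroid_d = column_matroid (mat_of_rows_list 8
     [[1, 0, 0, 0, 1, 0, 1, 1],
      [0, 1, 0, 0, 1, 1, 0, 1],
      [0, 0, 1, 0, 1, 1, 1, 0],
      [0, 0, 0, 1, 0, 1, 1, 1]] :: bit mat)"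

end

theory Submission
  imports Defs
begin

text \<open>
  Represent \<open>M\<close> by a binary matrix and call a set of elements a cycle if its columns sum to zero; cycles
  are closed under symmetric difference and determine the matroid. Let \<open>k\<close> be the rank and suppose
  \<open>\<eta>(E) \<ge> 3\<close>. Let \<open>D\<close> be a nonempty cycle of minimum size, and suppose \<open>|D| < k\<close>. By minimality \<open>D\<close> is a
  flat, so by the height assumption every cycle \<open>S\<close> not contained in \<open>D\<close> spans \<open>E\<close> together with \<open>D\<close>; in
  other words, in the contraction \<open>M/D\<close>, of rank at least 2 and nullity at least 2, all circuits are spanning.
  Adding the fundamental cycles of two elements outside a basis yields a dependent pair of \<open>M/D\<close>, a
  contradiction. Hence every nonempty cycle has at least \<open>k\<close> elements, and \<open>M\<close> is determined by its
  \<open>k\<close>-element cycles, the circuit-hyperplanes.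

  Now fix a basis \<open>B\<close>. The fundamental cycle of \<open>c \<notin> B\<close> misses at most one element of \<open>B\<close>, and the sum of
  two fundamental cycles has at least \<open>k\<close> elements, which forces \<open>k \<le> 4\<close> and at most four elements outside
  \<open>B\<close>, with distinct missing elements (one of them possibly absent if \<open>k = 3\<close>). The remaining possibilities
  are the four matroids of the statement.
\<close>

section \<open>Rank and zero-sum sets of columns\<close>

lemma set_cols_submatrix:
  assumes "X \<subseteq> {..<dim_col A}"
  shows "set (cols (submatrix A UNIV X)) = col A ` X"
proof -
  have eq: "{j. j < dim_col A \<and> j \<in> X} = X" using assms by auto
  have fin: "finite X" using assms finite_subset by blast
  have cc: "col (submatrix A UNIV X) j = col A (pick X j)" if j: "j < card X" for j
  proof (rule eq_vecI)
    fix i assume "i < dim_vec (col A (pick X j))"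
    then have i: "i < dim_row A" by simp
    have "pick X j \<in> X" using j pick_in_set_le by blast
    then have "pick X j < dim_col A" using assms by auto
    then show "col (submatrix A UNIV X) j $ i = col A (pick X j) $ i"
      using i j by (simp add: submatrix_def eq pick_UNIV)
  qed (simp add: dim_submatrix)
  have "set (cols (submatrix A UNIV X)) = col (submatrix A UNIV X) ` {..<card X}"
    by (auto simp: cols_def dim_submatrix eq)
  also have "\<dots> = col A ` (pick X ` {..<card X})"
    using cc by (auto simp: image_image)
  also have "pick X ` {..<card X} = X"
  proof
    show "pick X ` {..<card X} \<subseteq> X" using pick_in_set_le by blast
    show "X \<subseteq> pick X ` {..<card X}"
    proof
      fix x assume x: "x \<in> X"
      \<comment> \<open>\<open>pick X\<close> enumerates \<open>X\<close> in increasing order, so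
        \<open>x\<close> is picked at the position that counts the smaller elements of
        \<open>X\<close>.\<close>
      have "{a \<in> X. a < x} \<subset> X" using x by auto
      then have "card {a \<in> X. a < x} < card X" using fin psubset_card_mono by blast
      then show "x \<in> pick X ` {..<card X}" using pick_card_in_set[OF x] by force
    qed
  qed
  finally show ?thesis .
qed

section \<open>Linear independence of sets of columns\<close>

context vec_space
begin

lemma cols_in_carrier: "A \<in> carrier_mat n nc \<Longrightarrow> col A ` X \<subseteq> carrier_vec n"
  using col_dim[of A] by (auto simp: carrier_matD)

lemma submatrix_carrier:
  assumes "A \<in> carrier_mat n nc" "X \<subseteq> {..<nc}"
  shows "submatrix A UNIV X \<in> carrier_mat n (card X)"
proof -
  have "{j. j < dim_col A \<and> j \<in> X} = X" using assms by auto
  moreover have "{i. i < dim_row A \<and> i \<in> UNIV} = {..<n}" using assms(1) by auto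
  ultimately show ?thesis by (intro carrier_matI) (simp_all only: dim_submatrix card_lessThan)
qed

lemma set_cols_submatrix_carrier:
  assumes "A \<in> carrier_mat n nc" "X \<subseteq> {..<nc}"
  shows "set (cols (submatrix A UNIV X)) = col A ` X"
  using assms by (intro set_cols_submatrix) auto

text \<open>A maximal independent set of columns attains the rank. It is a set of vectors, so
  repeated columns contribute only once.\<close>

lemma rank_submatrix_obtain:
  assumes A: "A \<in> carrier_mat n nc" and X: "X \<subseteq> {..<nc}"
  obtains U where "U \<subseteq> col A ` X" "lin_indpt U" "finite U" "rank (submatrix A UNIV X) = card U"
proof -
  have "lin_indpt {}" by (rule finite_lin_indpt2) auto
  then have "\<exists>S. finite S \<and> maximal S (\<lambda>T. T \<subseteq> set (cols (submatrix A UNIV X)) \<and> lin_indpt T) \<and> {} \<subseteq> S"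
    by (intro maximal_exists_superset[OF finite_set[of "cols (submatrix A UNIV X)"]]) simp_all
  then obtain S where S: "maximal S (\<lambda>T. T \<subseteq> set (cols (submatrix A UNIV X)) \<and> lin_indpt T)"
    and "finite S" by blast
  show thesis
  proof
    show "rank (submatrix A UNIV X) = card S"
      by (rule rank_card_indpt[OF submatrix_carrier[OF A X] S])
    show "S \<subseteq> col A ` X" "lin_indpt S"
      using S set_cols_submatrix_carrier[OF A X] unfolding maximal_def by auto
    show "finite S" by fact
  qed
qed

lemma rank_submatrix_mono:
  assumes A: "A \<in> carrier_mat n nc" and "X \<subseteq> Y" and Y: "Y \<subseteq> {..<nc}"
  shows "rank (submatrix A UNIV X) \<le> rank (submatrix A UNIV Y)"
proof -
  have X: "X \<subseteq> {..<nc}" using assms by blast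
  obtain U where U: "U \<subseteq> col A ` X" "lin_indpt U" "rank (submatrix A UNIV X) = card U"
    using rank_submatrix_obtain[OF A X] by blast
  have "U \<subseteq> set (cols (submatrix A UNIV Y))"
    using U(1) assms(2) unfolding set_cols_submatrix_carrier[OF A Y] by blast
  from rank_ge_card_indpt[OF submatrix_carrier[OF A Y] this U(2)] show ?thesis
    using U(3) by simp
qed

lemma rank_submatrix_le:
  assumes A: "A \<in> carrier_mat n nc" and X: "X \<subseteq> {..<nc}"
  shows "rank (submatrix A UNIV X) \<le> n"
proof -
  obtain U where U: "U \<subseteq> col A ` X" "lin_indpt U" "rank (submatrix A UNIV X) = card U"
    using rank_submatrix_obtain[OF A X] by blast
  have "U \<subseteq> carrier_vec n" using U(1) A cols_in_carrier by blast
  then have "card U \<le> dim" using U(2) li_le_dim(2) fin_dim by blast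
  then show ?thesis using U(3) dim_is_n by simp
qed

text \<open>Independence is a property of a set of vectors, so repeated columns have to be excluded
  separately. An independent \<open>U\<close> of \<open>card X\<close> vectors in the image of
  \<open>X\<close> leaves room neither for a collision nor for a vector outside
  \<open>U\<close>.\<close>

lemma rank_submatrix_eq_card_iff_lin_indpt:
  assumes A: "A \<in> carrier_mat n nc" and X: "X \<subseteq> {..<nc}"
  shows "rank (submatrix A UNIV X) = card X \<longleftrightarrow> inj_on (col A) X \<and> lin_indpt (col A ` X)"
proof
  have fin: "finite X" using X finite_subset by blast
  assume r: "rank (submatrix A UNIV X) = card X"
  obtain U where U: "U \<subseteq> col A ` X" "lin_indpt U" "finite U" "rank (submatrix A UNIV X) = card U"
    using rank_submatrix_obtain[OF A X] by blast
  have "card U \<le> card (col A ` X)" by (rule card_mono[OF finite_imageI[OF fin] U(1)])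
  moreover have "card (col A ` X) \<le> card X" by (rule card_image_le[OF fin])
  ultimately have "card (col A ` X) = card X" "card U = card (col A ` X)" using r U(4) by auto
  then have "inj_on (col A) X" "U = col A ` X"
    using eq_card_imp_inj_on[OF fin] card_subset_eq[OF finite_imageI[OF fin] U(1)] by simp_all
  then show "inj_on (col A) X \<and> lin_indpt (col A ` X)" using U(2) by simp
next
  assume *: "inj_on (col A) X \<and> lin_indpt (col A ` X)"
  have "card (col A ` X) \<le> rank (submatrix A UNIV X)"
    by (rule rank_ge_card_indpt[OF submatrix_carrier[OF A X]])
      (use * set_cols_submatrix_carrier[OF A X] in simp_all)
  moreover have "card (col A ` X) = card X" using * card_image by blast
  ultimately have "card X \<le> rank (submatrix A UNIV X)" by simp
  then show "rank (submatrix A UNIV X) = card X"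
    using rank_le_nc[OF submatrix_carrier[OF A X]] by simp
qed

text \<open>Passes from coefficients on vectors to coefficients on column indices. The index version
  detects repeated columns by itself, since they satisfy a relation with coefficients 1 and
  -1.\<close>

lemma rank_submatrix_eq_card_iff:
  assumes A: "A \<in> carrier_mat n nc" and X: "X \<subseteq> {..<nc}"
  shows "rank (submatrix A UNIV X) = card X \<longleftrightarrow>
    (\<forall>c. (\<forall>i<n. (\<Sum>j\<in>X. c j * A $$ (i, j)) = 0) \<longrightarrow> (\<forall>j\<in>X. c j = 0))"
proof -
  have fin: "finite X" using X finite_subset by blast
  have carr: "col A ` X \<subseteq> carrier_vec n" using A cols_in_carrier by blast
  have lin: "lincomb a (col A ` X) = 0\<^sub>v n \<longleftrightarrow> (\<forall>i<n. (\<Sum>j\<in>X. a (col A j) * A $$ (i, j)) = 0)"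
    if inj: "inj_on (col A) X" for a
  proof -
    have "lincomb a (col A ` X) $ i = (\<Sum>j\<in>X. a (col A j) * A $$ (i, j))" if i: "i < n" for i
    proof -
      have "lincomb a (col A ` X) $ i = (\<Sum>x\<in>col A ` X. a x * x $ i)"
        by (rule lincomb_index[OF i carr])
      also have "\<dots> = (\<Sum>j\<in>X. a (col A j) * col A j $ i)"
        by (simp add: sum.reindex[OF inj])
      finally show ?thesis using X A i by (auto intro!: sum.cong)
    qed
    moreover have "dim_vec (lincomb a (col A ` X)) = n"
      using carr fin by (intro lincomb_dim) auto
    ultimately show ?thesis by (auto simp: vec_eq_iff)
  qed
  show ?thesis unfolding rank_submatrix_eq_card_iff_lin_indpt[OF A X]
  proof (intro iffI conjI allI impI ballI; (elim conjE)?)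
    fix c j assume inj: "inj_on (col A) X" and li: "lin_indpt (col A ` X)"
      and c: "\<forall>i<n. (\<Sum>j\<in>X. c j * A $$ (i, j)) = 0" and j: "j \<in> X"
    \<comment> \<open>Injectivity of \<open>col A\<close> on \<open>X\<close> lets the coefficients
      be carried from indices to vectors.\<close>
    define a where "a = c \<circ> inv_into X (col A)"
    have a: "a (col A j) = c j" if "j \<in> X" for j using that inj by (simp add: a_def)
    have "lincomb a (col A ` X) = 0\<^sub>v n" using lin[OF inj, of a] c a by simp
    moreover have "col A j \<in> col A ` X" using j by auto
    ultimately have "a (col A j) = 0"
      using lin_dep_crit[where A = "col A ` X" and S = "col A ` X" and a = a and v = "col A j"]
        li finite_imageI[OF fin] by fastforce
    then show "c j = 0" using a j by simp
  next
    assume z: "\<forall>c. (\<forall>i<n. (\<Sum>j\<in>X. c j * A $$ (i, j)) = 0) \<longrightarrow> (\<forall>j\<in>X. c j = 0)"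
    show inj: "inj_on (col A) X"
    proof (rule inj_onI, rule ccontr)
      fix p q assume pq: "p \<in> X" "q \<in> X" "col A p = col A q" "p \<noteq> q"
      define c where "c j = (if j = p then 1 else if j = q then - 1 else 0 :: 'a)" for j
      have "(\<Sum>j\<in>X. c j * A $$ (i, j)) = 0" if "i < n" for i
      proof -
        have "(\<Sum>j\<in>X. c j * A $$ (i, j)) = (\<Sum>j\<in>{p, q}. c j * A $$ (i, j))"
          using pq fin by (intro sum.mono_neutral_right) (auto simp: c_def)
        also have "\<dots> = A $$ (i, p) - A $$ (i, q)" using pq by (simp add: c_def)
        also have "A $$ (i, p) = col A p $ i" using pq(1) that A X by (subst index_col) auto
        also have "\<dots> = A $$ (i, q)" unfolding pq(3) using pq(2) that A X by (subst index_col) auto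
        finally show ?thesis by simp
      qed
      then have "c p = 0" using z pq(1) by blast
      then show False by (simp add: c_def)
    qed
    show "lin_indpt (col A ` X)"
    proof
      assume "lin_dep (col A ` X)"
      then obtain a v where av: "lincomb a (col A ` X) = 0\<^sub>v n" "v \<in> col A ` X" "a v \<noteq> 0"
        using finite_lin_dep[OF finite_imageI[OF fin] _ carr] by fastforce
      have "\<forall>i<n. (\<Sum>j\<in>X. a (col A j) * A $$ (i, j)) = 0"
        by (rule iffD1[OF lin[OF inj, of a] av(1)])
      then have "\<forall>j\<in>X. a (col A j) = 0"
        by (rule mp[OF spec[OF z, of "\<lambda>j. a (col A j)"]])
      then show False using av(2,3) by blast
    qed
  qed
qed

end

text \<open>The kernel of \<open>A\<close> over F_2, with each vector replaced by its support; this
  is the cycle space of the column matroid.\<close>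

definition zero_sums :: "bit mat \<Rightarrow> nat set set" where
  "zero_sums A = {S. S \<subseteq> {..<dim_col A} \<and> (\<forall>i<dim_row A. (\<Sum>j\<in>S. A $$ (i, j)) = 0)}"

lemma ground_column_matroid [simp]: "ground (column_matroid A) = {..<dim_col A}"
  by (simp add: column_matroid_def)

lemma rk_column_matroid_mono:
  assumes "X \<subseteq> Y" "Y \<subseteq> {..<dim_col A}"
  shows "rk (column_matroid A) X \<le> rk (column_matroid A) Y"
  unfolding column_matroid_def rank_space.select_convs
  by (rule vec_space.rank_submatrix_mono[OF carrier_matI[OF refl refl] assms])

lemma rk_column_matroid_le_dim_row:
  assumes "X \<subseteq> {..<dim_col A}"
  shows "rk (column_matroid A) X \<le> dim_row A"
  unfolding column_matroid_def rank_space.select_convs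
  by (rule vec_space.rank_submatrix_le[OF carrier_matI[OF refl refl] assms])

lemma rk_column_matroid_le_card:
  assumes "X \<subseteq> {..<dim_col A}"
  shows "rk (column_matroid A) X \<le> card X"
  unfolding column_matroid_def rank_space.select_convs
  by (rule vec_space.rank_le_nc[OF vec_space.submatrix_carrier[OF carrier_matI[OF refl refl] assms]])

text \<open>Over F_2 a coefficient function is the indicator of its support, so linear relations
  among the columns in \<open>X\<close> are the zero-sum sets inside \<open>X\<close>.\<close>

lemma rk_column_matroid_eq_card_iff:
  assumes X: "X \<subseteq> {..<dim_col A}"
  shows "rk (column_matroid A) X = card X \<longleftrightarrow> (\<forall>S\<in>zero_sums A. S \<subseteq> X \<longrightarrow> S = {})"
proof -
  have fin: "finite X" using X finite_subset by blast
  have supp: "(\<Sum>j\<in>X. c j * A $$ (i, j)) = (\<Sum>j\<in>{j\<in>X. c j = 1}. A $$ (i, j))" for c :: "nat \<Rightarrow> bit" and i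
  proof -
    have "(\<Sum>j\<in>X. c j * A $$ (i, j)) = (\<Sum>j\<in>X. if c j = 1 then A $$ (i, j) else 0)"
      by (intro sum.cong) auto
    then show ?thesis unfolding sum.inter_filter[OF fin] .
  qed
  have "rk (column_matroid A) X = card X \<longleftrightarrow>
    (\<forall>c :: nat \<Rightarrow> bit. (\<forall>i<dim_row A. (\<Sum>j\<in>{j\<in>X. c j = 1}. A $$ (i, j)) = 0) \<longrightarrow> (\<forall>j\<in>X. c j = 0))"
    using vec_space.rank_submatrix_eq_card_iff[OF carrier_matI[OF refl refl] X]
    unfolding supp column_matroid_def rank_space.select_convs .
  also have "\<dots> \<longleftrightarrow> (\<forall>S\<in>zero_sums A. S \<subseteq> X \<longrightarrow> S = {})"
  proof (intro iffI ballI impI allI)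
    fix S assume *: "\<forall>c :: nat \<Rightarrow> bit. (\<forall>i<dim_row A. (\<Sum>j\<in>{j\<in>X. c j = 1}. A $$ (i, j)) = 0) \<longrightarrow> (\<forall>j\<in>X. c j = 0)"
      and S: "S \<in> zero_sums A" "S \<subseteq> X"
    have supp_S: "{j\<in>X. (if j \<in> S then 1 else 0 :: bit) = 1} = S" using S(2) by auto
    have "\<forall>i<dim_row A. (\<Sum>j\<in>S. A $$ (i, j)) = 0" using S(1) unfolding zero_sums_def by blast
    then have "\<forall>j\<in>X. (if j \<in> S then 1 else 0 :: bit) = 0"
      using spec[OF *, of "\<lambda>j. if j \<in> S then 1 else 0"] unfolding supp_S by iprover
    then have "j \<notin> S" for j using S(2) zero_neq_one[where 'a=bit] by (metis subsetD)
    then show "S = {}" by blast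
  next
    fix c :: "nat \<Rightarrow> bit" and j
    assume *: "\<forall>S\<in>zero_sums A. S \<subseteq> X \<longrightarrow> S = {}"
      and c: "\<forall>i<dim_row A. (\<Sum>j\<in>{j\<in>X. c j = 1}. A $$ (i, j)) = 0" and j: "j \<in> X"
    have mem: "{j\<in>X. c j = 1} \<in> zero_sums A" using c X unfolding zero_sums_def by blast
    have "{j\<in>X. c j = 1} = {}" by (rule mp[OF bspec[OF * mem]]) (rule Collect_subset)
    then have "c j \<noteq> 1" using j by blast
    then show "c j = 0" by simp
  qed
  finally show ?thesis .
qed

text \<open>The common part of \<open>S\<close> and \<open>T\<close> is counted twice on the right
  and cancels in characteristic 2.\<close>

lemma sum_sym_diff_bit:
  fixes f :: "'b \<Rightarrow> bit"
  assumes "finite S" "finite T"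
  shows "sum f (sym_diff S T) = sum f S + sum f T"
proof -
  have S: "sum f S = sum f (S - T) + sum f (S \<inter> T)"
    using assms by (metis sum.Int_Diff add.commute)
  have T: "sum f T = sum f (T - S) + sum f (S \<inter> T)"
    using assms by (metis sum.Int_Diff add.commute Int_commute)
  have "sum f (sym_diff S T) = sum f (S - T) + sum f (T - S)"
    using assms by (intro sum.union_disjoint) auto
  moreover have "a + b = (a + c) + (b + c)" for a b c :: bit
    by (cases a; cases b; cases c) simp_all
  ultimately show ?thesis unfolding S T by simp
qed

section \<open>Sparse paving matroids\<close>

text \<open>
  \<open>H\<close> is the set of circuit-hyperplanes. The bounds on \<open>k\<close> are exchanged by duality.
\<close>

locale sparse_paving =
  fixes M :: "'a rank_space" and k :: nat and H :: "'a set set"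
  assumes finite_ground: "finite (ground M)"
    and two_le: "2 \<le> k"
    and corank: "k + 2 \<le> card (ground M)"
    and hyperplane: "X \<in> H \<Longrightarrow> X \<subseteq> ground M \<and> card X = k"
    and inter: "X \<in> H \<Longrightarrow> Y \<in> H \<Longrightarrow> X \<noteq> Y \<Longrightarrow> card (X \<inter> Y) + 2 \<le> k"
    and rk_eq: "X \<subseteq> ground M \<Longrightarrow> rk M X = (if X \<in> H then k - 1 else min (card X) k)"
begin

lemma rk_ground: "rk M (ground M) = k"
  using rk_eq[of "ground M"] hyperplane[of "ground M"] corank by auto

lemma rk_le: "X \<subseteq> ground M \<Longrightarrow> rk M X \<le> min (card X) k"
  using rk_eq[of X] hyperplane[of X] by auto

lemma rk_small: "X \<subseteq> ground M \<Longrightarrow> card X < k \<Longrightarrow> rk M X = card X"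
  using rk_eq[of X] hyperplane[of X] by auto

lemma rk_large: "X \<subseteq> ground M \<Longrightarrow> k < card X \<Longrightarrow> rk M X = k"
  using rk_eq[of X] hyperplane[of X] by auto

lemma finite_subset_ground: "X \<subseteq> ground M \<Longrightarrow> finite X"
  using finite_ground finite_subset by blast

text \<open>For incomparable sets the intersection is strictly smaller than both, which makes up for
  the rank lost on one circuit-hyperplane; if both sets are circuit-hyperplanes,
  \<open>inter\<close> makes up for both units.\<close>

lemma rk_submodular:
  assumes X: "X \<subseteq> ground M" and Y: "Y \<subseteq> ground M"
  shows "rk M (X \<union> Y) + rk M (X \<inter> Y) \<le> rk M X + rk M Y"
proof (cases "X \<subseteq> Y \<or> Y \<subseteq> X")
  case True
  then show ?thesis by (auto simp: Un_absorb1 Un_absorb2 Int_absorb1 Int_absorb2)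
next
  case False
  have fin: "finite X" "finite Y" using X Y finite_ground finite_subset by blast+
  have sum: "card (X \<union> Y) + card (X \<inter> Y) = card X + card Y"
    using card_Un_Int[OF fin] by simp
  have lt: "card (X \<inter> Y) < card X" "card (X \<inter> Y) < card Y"
    by (rule psubset_card_mono; use fin False in blast)+
  have le: "rk M (X \<union> Y) \<le> min (card (X \<union> Y)) k" "rk M (X \<inter> Y) \<le> min (card (X \<inter> Y)) k"
    by (rule rk_le; use X Y in blast)+
  have "X \<noteq> Y" using False by blast
  then show ?thesis
    using rk_eq[OF X] rk_eq[OF Y] le lt sum inter[of X Y] hyperplane[of X] hyperplane[of Y]
    by (auto simp: min_def split: if_splits)
qed

lemma matroid: "matroid M"
  unfolding matroid_def
proof (intro conjI allI impI)
  show "finite (ground M)" by (rule finite_ground)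
  fix X Y
  show "rk M X \<le> card X" if "X \<subseteq> ground M"
    using rk_eq[OF that] hyperplane[of X] by auto
  show "rk M X \<le> rk M Y" if "X \<subseteq> Y \<and> Y \<subseteq> ground M"
  proof (cases "X = Y")
    case False
    have "finite Y" using that finite_ground finite_subset by blast
    then have "card X < card Y" using False that by (intro psubset_card_mono) auto
    then show ?thesis
      using rk_eq[of X] rk_eq[of Y] hyperplane[of X] hyperplane[of Y] that by auto
  qed simp
  show "rk M (X \<union> Y) + rk M (X \<inter> Y) \<le> rk M X + rk M Y" if "X \<subseteq> ground M \<and> Y \<subseteq> ground M"
    using rk_submodular that by blast
qed

text \<open>Sets of deficient rank have at most \<open>k\<close> elements, so their complements have
  at least \<open>card (ground M) - k\<close>; the complement of a circuit-hyperplane attains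
  this.\<close>

lemma min_distance:
  assumes "H \<noteq> {}"
  shows "min_distance M = card (ground M) - k"
  unfolding min_distance_def
proof (rule Min_eqI)
  show "finite {card X |X. X \<subseteq> ground M \<and> rk M (ground M - X) < rk M (ground M)}"
    using finite_ground by simp
  show "card (ground M) - k \<le> y"
    if "y \<in> {card X |X. X \<subseteq> ground M \<and> rk M (ground M - X) < rk M (ground M)}" for y
  proof -
    obtain X where X: "X \<subseteq> ground M" "rk M (ground M - X) < k" "y = card X"
      using \<open>y \<in> _\<close> rk_ground by auto
    have "card (ground M - X) \<le> k"
      using X rk_eq[of "ground M - X"] hyperplane[of "ground M - X"] by (auto split: if_splits)
    then show ?thesis using X finite_ground
      by (simp add: card_Diff_subset finite_subset)
  qed
  obtain Y where Y: "Y \<in> H" using assms by blast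
  then have "Y \<subseteq> ground M" "card Y = k" using hyperplane by auto
  moreover have "ground M - (ground M - Y) = Y" using \<open>Y \<subseteq> ground M\<close> by blast
  moreover have "rk M Y < k" using rk_eq[OF \<open>Y \<subseteq> ground M\<close>] Y two_le by simp
  ultimately show "card (ground M) - k \<in> {card X |X. X \<subseteq> ground M \<and> rk M (ground M - X) < rk M (ground M)}"
    using rk_ground finite_ground
    by (auto intro!: exI[of _ "ground M - Y"] simp: card_Diff_subset finite_subset)
qed

lemma nkd_matroid:
  assumes "H \<noteq> {}"
  shows "nkd_matroid M (card (ground M)) k (card (ground M) - k)"
  using matroid rk_ground min_distance[OF assms] by (simp add: nkd_matroid_def)

section \<open>Cyclic flats and atoms of a sparse paving matroid\<close>

lemma cyclic_flat_cases:
  assumes "X \<in> cyclic_flats M"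
  shows "X = {} \<or> X = ground M \<or> X \<in> H"
proof -
  have sub: "X \<subseteq> ground M" and cl: "cl M X = X" and cyc: "cyc M X = X"
    using assms by (auto simp: cyclic_flats_def)
  note fin = finite_subset_ground[OF sub]
  \<comment> \<open>Every element of an independent set lowers the rank when deleted, so only the
    empty one is cyclic. A set with more than \<open>k\<close> elements spans, so it is closed only
    if it is the ground set.\<close>
  consider "rk M X = card X" | "X \<in> H" | "k < card X"
    using rk_eq[OF sub] by (cases "k < card X"; cases "X \<in> H") auto
  then show ?thesis
  proof cases
    case 1
    have False if "e \<in> X" for e
    proof -
      have "e \<in> cyc M X" unfolding cyc by (rule that)
      then have "rk M (X - {e}) = rk M X" by (simp add: cyc_def)
      moreover have "rk M (X - {e}) \<le> card (X - {e})" using rk_le[of "X - {e}"] sub by auto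
      moreover have "card (X - {e}) < card X" by (rule card_Diff1_less[OF fin that])
      ultimately show False using 1 by simp
    qed
    then show ?thesis by blast
  next
    case 3
    have "e \<in> X" if "e \<in> ground M" for e
    proof -
      have "card X \<le> card (X \<union> {e})" using fin by (intro card_mono) auto
      then have "rk M (X \<union> {e}) = rk M X"
        using rk_large[OF sub 3] rk_large[of "X \<union> {e}"] 3 sub that by simp
      then have "e \<in> cl M X" using that by (simp add: cl_def)
      then show ?thesis unfolding cl .
    qed
    then show ?thesis using sub by blast
  qed simp
qed

text \<open>By \<open>two_le\<close> singletons are independent, so the empty set is closed.\<close>

lemma cyclic_flat_empty: "{} \<in> cyclic_flats M"
proof -
  have "rk M {} = 0" using rk_le[of "{}"] by simp
  moreover have "rk M {e} = 1" if "e \<in> ground M" for e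
    using rk_small[of "{e}"] that two_le by simp
  ultimately show ?thesis by (auto simp: cyclic_flats_def cl_def cyc_def)
qed

text \<open>By \<open>corank\<close> more than \<open>k\<close> elements remain after one deletion,
  and these have full rank.\<close>

lemma cyclic_flat_ground: "ground M \<in> cyclic_flats M"
proof -
  have "rk M (ground M - {e}) = k" if "e \<in> ground M" for e
    using rk_large[of "ground M - {e}"] corank that finite_ground by simp
  then show ?thesis using rk_ground by (auto simp: cyclic_flats_def cl_def cyc_def insert_absorb)
qed

text \<open>Deleting an element leaves \<open>k - 1\<close> independent elements; adding one gives
  more than \<open>k\<close> elements, hence full rank.\<close>

lemma cyclic_flat_hyperplane:
  assumes X: "X \<in> H"
  shows "X \<in> cyclic_flats M"
proof -
  have sub: "X \<subseteq> ground M" and card: "card X = k" and r: "rk M X = k - 1"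
    using X hyperplane rk_eq by auto
  note fin = finite_subset_ground[OF sub]
  have 1: "rk M (X - {e}) = rk M X" if "e \<in> X" for e
    unfolding r using rk_small[of "X - {e}"] that card subset_trans[OF Diff_subset sub] two_le fin by simp
  have 2: "rk M (X \<union> {e}) \<noteq> rk M X" if "e \<in> ground M" "e \<notin> X" for e
    unfolding r using rk_large[of "X \<union> {e}"] that card sub fin two_le by simp
  have 3: "X \<union> {e} = X" if "e \<in> X" for e using that by blast
  have "cl M X = X"
  proof (rule Set.set_eqI)
    show "e \<in> cl M X \<longleftrightarrow> e \<in> X" for e
      using 2[of e] 3[of e] sub by (cases "e \<in> X") (auto simp only: cl_def mem_Collect_eq)
  qed
  moreover have "cyc M X = X" unfolding cyc_def using 1 by auto
  ultimately show ?thesis using sub by (simp add: cyclic_flats_def)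
qed

lemma cyclic_flats: "cyclic_flats M = insert {} (insert (ground M) H)"
  using cyclic_flat_cases cyclic_flat_empty cyclic_flat_ground cyclic_flat_hyperplane by blast

text \<open>All members of \<open>H\<close> have \<open>k\<close> elements, so they form an
  antichain strictly between the empty set and the ground set.\<close>

lemma atoms:
  assumes "H \<noteq> {}"
  shows "atoms (cyclic_flats M) = H"
proof -
  have least: "(LEAST X. X \<in> cyclic_flats M) = {}"
    by (rule Least_equality) (auto simp: cyclic_flats)
  have ne: "{} \<subset> X \<and> X \<subset> ground M" if "X \<in> H" for X
    using hyperplane[OF that] two_le corank by auto
  have anti: "\<not> X \<subset> Y" if "X \<in> H" "Y \<in> H" for X Y
    using hyperplane[OF that(1)] hyperplane[OF that(2)] finite_ground psubset_card_mono finite_subset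
    by (metis less_irrefl)
  \<comment> \<open>A member of \<open>H\<close> lies strictly below the ground set and keeps it
    from being an atom.\<close>
  obtain Y where Y: "Y \<in> H" using assms by blast
  show ?thesis unfolding atoms_def least Let_def unfolding cyclic_flats
  proof (intro Set.set_eqI iffI)
    fix X
    assume "X \<in> {A \<in> insert {} (insert (ground M) H). {} \<subset> A \<and>
        \<not> (\<exists>B\<in>insert {} (insert (ground M) H). {} \<subset> B \<and> B \<subset> A)}"
    then show "X \<in> H" using Y ne[OF Y] by auto
  next
    fix X assume X: "X \<in> H"
    have "\<not> B \<subset> X" if "B \<in> insert (ground M) H" for B
      using that ne[OF X] anti[OF _ X] by auto
    then show "X \<in> {A \<in> insert {} (insert (ground M) H). {} \<subset> A \<and>
        \<not> (\<exists>B\<in>insert {} (insert (ground M) H). {} \<subset> B \<and> B \<subset> A)}"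
      using X ne[OF X] by auto
  qed
qed

section \<open>Duality\<close>

lemma mem_complement_iff:
  assumes "A \<subseteq> ground M"
  shows "A \<in> (\<lambda>X. ground M - X) ` H \<longleftrightarrow> ground M - A \<in> H"
proof
  assume "A \<in> (\<lambda>X. ground M - X) ` H"
  then obtain X where "X \<in> H" "A = ground M - X" by blast
  then show "ground M - A \<in> H" using hyperplane[of X] by (simp add: double_diff)
next
  assume "ground M - A \<in> H"
  then show "A \<in> (\<lambda>X. ground M - X) ` H"
    using assms by (intro image_eqI[of _ _ "ground M - A"]) auto
qed

text \<open>Circuit-hyperplanes of the dual are the complements of those of \<open>M\<close>. Two
  complements meet in \<open>card (ground M) + card (X' \<inter> Y') - 2 * k\<close> elements, which
  turns \<open>inter\<close> into the same condition for the dual rank.\<close>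

lemma dual:
  "sparse_paving (matroid_dual M) (card (ground M) - k) ((\<lambda>X. ground M - X) ` H)"
proof
  show "finite (ground (matroid_dual M))" using finite_ground by (simp add: matroid_dual_def)
  show "2 \<le> card (ground M) - k" using corank by simp
  show "card (ground M) - k + 2 \<le> card (ground (matroid_dual M))"
    using two_le corank by (simp add: matroid_dual_def)
  have card_compl: "card (ground M - X) = card (ground M) - card X" if "X \<subseteq> ground M" for X
    using that finite_ground by (simp add: card_Diff_subset finite_subset)
  show "X \<subseteq> ground (matroid_dual M) \<and> card X = card (ground M) - k"
    if "X \<in> (\<lambda>X. ground M - X) ` H" for X
    using that hyperplane card_compl by (auto simp: matroid_dual_def)
  show "card (X \<inter> Y) + 2 \<le> card (ground M) - k"
    if "X \<in> (\<lambda>X. ground M - X) ` H" "Y \<in> (\<lambda>X. ground M - X) ` H" "X \<noteq> Y" for X Y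
  proof -
    obtain X' Y' where H: "X' \<in> H" "Y' \<in> H" "X = ground M - X'" "Y = ground M - Y'"
      using \<open>X \<in> _\<close> \<open>Y \<in> _\<close> by blast
    have sub: "X' \<subseteq> ground M" "card X' = k" "Y' \<subseteq> ground M" "card Y' = k"
      using H hyperplane by auto
    have "X' \<noteq> Y'" using H \<open>X \<noteq> Y\<close> by blast
    then have i: "card (X' \<inter> Y') + 2 \<le> k" using inter H by blast
    have "card (X' \<union> Y') + card (X' \<inter> Y') = 2 * k"
      using card_Un_Int[of X' Y'] sub finite_ground finite_subset by (metis mult_2)
    moreover have "card (X' \<union> Y') \<le> card (ground M)"
      using sub finite_ground by (intro card_mono) auto
    moreover have "X \<inter> Y = ground M - (X' \<union> Y')" using H by blast
    ultimately show ?thesis using i card_compl[of "X' \<union> Y'"] sub by auto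
  qed
  show "rk (matroid_dual M) A =
      (if A \<in> (\<lambda>X. ground M - X) ` H then card (ground M) - k - 1
       else min (card A) (card (ground M) - k))"
    if "A \<subseteq> ground (matroid_dual M)" for A
  proof -
    have A: "A \<subseteq> ground M" using that by (simp add: matroid_dual_def)
    have "card A \<le> card (ground M)" using A finite_ground by (rule card_mono[rotated])
    then show ?thesis
      unfolding mem_complement_iff[OF A]
      using rk_eq[of "ground M - A"] card_compl[OF A] rk_ground two_le corank hyperplane[of "ground M - A"]
      by (auto simp: matroid_dual_def)
  qed
qed

end

text \<open>The rank function is determined by \<open>k\<close> and the circuit-hyperplanes, so only
  these need to correspond.\<close>

lemma matroid_iso_sparse_paving:
  assumes "sparse_paving M k H" and "sparse_paving N k H'"
    and f: "bij_betw f (ground M) (ground N)"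
    and H: "\<And>X. X \<subseteq> ground M \<Longrightarrow> f ` X \<in> H' \<longleftrightarrow> X \<in> H"
  shows "matroid_iso M N"
  unfolding matroid_iso_def
proof (intro exI conjI allI impI)
  interpret M: sparse_paving M k H by fact
  interpret N: sparse_paving N k H' by fact
  show "bij_betw f (ground M) (ground N)" by fact
  fix X assume X: "X \<subseteq> ground M"
  then have "f ` X \<subseteq> ground N" using f by (auto simp: bij_betw_def)
  moreover have "card (f ` X) = card X"
    using f X by (intro card_image) (auto simp: bij_betw_def inj_on_subset)
  ultimately show "rk N (f ` X) = rk M X" using H[OF X] M.rk_eq[OF X] N.rk_eq by auto
qed

section \<open>Families of cycles\<close>

lemma two_le_card_obtain:
  assumes "2 \<le> card A"
  obtains a b where "a \<in> A" "b \<in> A" "a \<noteq> b"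
proof -
  obtain U where "U \<subseteq> A" "card U = 2" using obtain_subset_with_card_n[OF assms] by blast
  then show thesis using that unfolding card_2_iff by blast
qed

text \<open>
  \<open>C\<close> stands for the family of zero-sum sets of columns. Submodularity of the rank is added only later,
  since it need not be shown for column matroids.
\<close>

locale binary_cycles =
  fixes M :: "'a rank_space" and C :: "'a set set"
  assumes finite_ground: "finite (ground M)"
    and rk_le_card: "X \<subseteq> ground M \<Longrightarrow> rk M X \<le> card X"
    and rk_mono: "X \<subseteq> Y \<Longrightarrow> Y \<subseteq> ground M \<Longrightarrow> rk M X \<le> rk M Y"
    and cycle_subset: "S \<in> C \<Longrightarrow> S \<subseteq> ground M"
    and empty_cycle: "{} \<in> C"
    and sym_diff_cycle: "S \<in> C \<Longrightarrow> T \<in> C \<Longrightarrow> sym_diff S T \<in> C"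
    and indep_iff: "X \<subseteq> ground M \<Longrightarrow> rk M X = card X \<longleftrightarrow> (\<forall>S\<in>C. S \<subseteq> X \<longrightarrow> S = {})"
begin

lemma finite_subset_ground: "X \<subseteq> ground M \<Longrightarrow> finite X"
  using finite_ground finite_subset by blast

lemma sym_diff_cancel: "sym_diff S (sym_diff S T) = T"
  by blast

lemma indep_of_card_less:
  assumes "\<And>S. S \<in> C \<Longrightarrow> S \<noteq> {} \<Longrightarrow> k \<le> card S" and X: "X \<subseteq> ground M" "card X < k"
  shows "rk M X = card X"
  unfolding indep_iff[OF X(1)]
proof (intro ballI impI, rule ccontr)
  fix S assume "S \<in> C" "S \<subseteq> X" "S \<noteq> {}"
  moreover from this have "card S \<le> card X"
    using finite_subset_ground[OF X(1)] by (intro card_mono)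
  ultimately show False using assms(1)[of S] X(2) by simp
qed

text \<open>Sets smaller than \<open>k\<close> contain no nonempty cycle, so a
  \<open>k\<close>-element set is a basis unless it is itself a cycle, and every larger set contains
  a basis.\<close>

lemma sparse_paving_of_girth:
  assumes girth: "\<And>S. S \<in> C \<Longrightarrow> S \<noteq> {} \<Longrightarrow> k \<le> card S"
    and k: "3 \<le> k" "k + 2 \<le> card (ground M)" "rk M (ground M) \<le> k"
  shows "sparse_paving M k {S \<in> C. card S = k}"
proof
  note fin = finite_subset_ground
  show "finite (ground M)" by (rule finite_ground)
  show "2 \<le> k" "k + 2 \<le> card (ground M)" using k by auto
  show "X \<subseteq> ground M \<and> card X = k" if "X \<in> {S \<in> C. card S = k}" for X
    using that cycle_subset by blast
  show "card (X \<inter> Y) + 2 \<le> k"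
    if X: "X \<in> {S \<in> C. card S = k}" and Y: "Y \<in> {S \<in> C. card S = k}" and "X \<noteq> Y" for X Y
  proof -
    have f: "finite X" "finite Y" using X Y cycle_subset fin by auto
    have "card (sym_diff X Y) \<ge> k" using X Y \<open>X \<noteq> Y\<close> by (intro girth sym_diff_cycle) auto
    moreover have "card (sym_diff X Y) = card (X - Y) + card (Y - X)"
      using f by (intro card_Un_disjoint) auto
    moreover have "card (X - Y) + card (X \<inter> Y) = k"
      using X f by (metis (mono_tags, lifting) card_Int_Diff add.commute mem_Collect_eq)
    moreover have "card (Y - X) + card (X \<inter> Y) = k"
      using Y f by (metis (mono_tags, lifting) card_Int_Diff add.commute Int_commute mem_Collect_eq)
    \<comment> \<open>Together these facts give \<open>2 * card (X \<inter> Y) \<le> k\<close>, and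
      then \<open>k \<ge> 3\<close> yields the claim.\<close>
    ultimately show ?thesis using k(1) by linarith
  qed
  have small: "rk M X = card X" if "X \<subseteq> ground M" "card X < k" for X
    using girth that by (rule indep_of_card_less)
  have basis: "rk M X = k" if X: "X \<subseteq> ground M" "card X = k" "X \<notin> C" for X
  proof -
    have "S = {}" if S: "S \<in> C" "S \<subseteq> X" for S
    proof (rule ccontr)
      assume "S \<noteq> {}"
      then have "card X \<le> card S" using girth S(1) X(2) by simp
      then have "S = X" using S(2) fin[OF X(1)] by (meson card_seteq)
      then show False using S X by simp
    qed
    then show ?thesis using indep_iff[OF X(1)] X(2) by simp
  qed
  show "rk M X = (if X \<in> {S \<in> C. card S = k} then k - 1 else min (card X) k)"
    if X: "X \<subseteq> ground M" for X
  proof (cases "card X" k rule: linorder_cases)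
    case less
    then show ?thesis using small[OF X] by simp
  next
    case equal
    show ?thesis
    proof (cases "X \<in> C")
      case True
      have "rk M X \<noteq> card X" using True equal k(1) indep_iff[OF X] by fastforce
      then have "rk M X < k" using rk_le_card[OF X] equal by simp
      moreover obtain e where "e \<in> X" using equal k(1) by fastforce
      then have "card (X - {e}) = k - 1" using equal fin[OF X] by simp
      then have "k - 1 \<le> rk M X"
        using small[of "X - {e}"] rk_mono[of "X - {e}" X] subset_trans[OF Diff_subset X] X k(1) by auto
      ultimately show ?thesis using True equal by simp
    qed (use basis[OF X equal] equal in simp)
  next
    case greater
    \<comment> \<open>Among any \<open>k + 1\<close> elements some \<open>k\<close> form a basis: if
      all \<open>k\<close>-subsets of \<open>T\<close> were cycles, two of them would add up to a
      two-element cycle.\<close>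
    obtain T where T: "T \<subseteq> X" "card T = k + 1"
      using obtain_subset_with_card_n[of "k + 1" X] greater by auto
    have "2 \<le> card T" using T k by simp
    then obtain a b where ab: "a \<in> T" "b \<in> T" "a \<noteq> b" by (rule two_le_card_obtain)
    have "\<exists>Y. Y \<subseteq> T \<and> card Y = k \<and> Y \<notin> C"
    proof (rule ccontr)
      assume *: "\<nexists>Y. Y \<subseteq> T \<and> card Y = k \<and> Y \<notin> C"
      have "T - {a} \<in> C" "T - {b} \<in> C"
        using * T(2) ab(1,2) by (metis Diff_subset add_diff_cancel_right' card_Diff_singleton)+
      then have "sym_diff (T - {a}) (T - {b}) \<in> C" by (rule sym_diff_cycle)
      moreover have "sym_diff (T - {a}) (T - {b}) = {a, b}" using ab by blast
      ultimately have "k \<le> card {a, b}" using girth[of "{a, b}"] by auto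
      then show False using k(1) ab(3) by simp
    qed
    then obtain Y where Y: "Y \<subseteq> T" "card Y = k" "Y \<notin> C" by blast
    have "Y \<subseteq> X" using Y T by blast
    then have "k \<le> rk M X" using basis[of Y] rk_mono[of Y X] Y X by auto
    moreover have "rk M X \<le> k" using rk_mono[of X "ground M"] X k(3) by simp
    ultimately show ?thesis using greater by auto
  qed
qed

end

section \<open>Cycles of column matroids and their transport along bijections\<close>

lemma binary_cycles_column_matroid: "binary_cycles (column_matroid A) (zero_sums A)"
proof
  show "finite (ground (column_matroid A))" by simp
  show "{} \<in> zero_sums A" by (simp add: zero_sums_def)
  show "S \<subseteq> ground (column_matroid A)" if "S \<in> zero_sums A" for S
    using that by (simp add: zero_sums_def)
  show "sym_diff S T \<in> zero_sums A" if S: "S \<in> zero_sums A" and T: "T \<in> zero_sums A" for S T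
  proof -
    have sub: "S \<subseteq> {..<dim_col A}" "T \<subseteq> {..<dim_col A}" using S T by (simp_all add: zero_sums_def)
    then have fin: "finite S" "finite T" using finite_lessThan finite_subset by blast+
    show ?thesis using S T sub unfolding zero_sums_def
      by (auto simp: sum_sym_diff_bit[OF fin])
  qed
qed (simp_all only: ground_column_matroid rk_column_matroid_mono rk_column_matroid_le_card
    rk_column_matroid_eq_card_iff)

text \<open>Turns a representation into a family of cycles on the ground set of the represented
  matroid.\<close>

lemma (in binary_cycles) binary_cycles_pullback:
  assumes f: "bij_betw f (ground N) (ground M)"
    and rk: "\<And>X. X \<subseteq> ground N \<Longrightarrow> rk M (f ` X) = rk N X"
  shows "binary_cycles N {S. S \<subseteq> ground N \<and> f ` S \<in> C}"
proof -
  have inj: "inj_on f (ground N)" and im: "f ` ground N = ground M"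
    using f by (auto simp: bij_betw_def)
  have sub: "f ` X \<subseteq> ground M" if "X \<subseteq> ground N" for X using that im by blast
  have card: "card (f ` X) = card X" if "X \<subseteq> ground N" for X
    using inj that by (meson card_image inj_on_subset)
  show ?thesis
  proof
    show "finite (ground N)" using f finite_ground bij_betw_finite by blast
    show "rk N X \<le> card X" if "X \<subseteq> ground N" for X
      using rk_le_card[OF sub[OF that]] rk[OF that] card[OF that] by simp
    show "rk N X \<le> rk N Y" if "X \<subseteq> Y" "Y \<subseteq> ground N" for X Y
      using rk_mono[OF image_mono[OF that(1)] sub[OF that(2)]] rk that by (metis subset_trans)
    show "S \<subseteq> ground N" if "S \<in> {S. S \<subseteq> ground N \<and> f ` S \<in> C}" for S using that by blast
    show "{} \<in> {S. S \<subseteq> ground N \<and> f ` S \<in> C}" using empty_cycle by simp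
    show "sym_diff S T \<in> {S. S \<subseteq> ground N \<and> f ` S \<in> C}"
      if S: "S \<in> {S. S \<subseteq> ground N \<and> f ` S \<in> C}" and T: "T \<in> {S. S \<subseteq> ground N \<and> f ` S \<in> C}" for S T
    proof -
      have "S \<subseteq> ground N" "T \<subseteq> ground N" using S T by auto
      then have "S - T \<subseteq> ground N" "T - S \<subseteq> ground N" by blast+
      then have "f ` sym_diff S T = sym_diff (f ` S) (f ` T)"
        using \<open>S \<subseteq> ground N\<close> \<open>T \<subseteq> ground N\<close>
        by (simp add: image_Un inj_on_image_set_diff[OF inj])
      then show ?thesis using S T sym_diff_cycle[of "f ` S" "f ` T"] by auto
    qed
    show "rk N X = card X \<longleftrightarrow> (\<forall>S\<in>{S. S \<subseteq> ground N \<and> f ` S \<in> C}. S \<subseteq> X \<longrightarrow> S = {})"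
      if X: "X \<subseteq> ground N" for X
    proof -
      have "rk N X = card X \<longleftrightarrow> (\<forall>S\<in>C. S \<subseteq> f ` X \<longrightarrow> S = {})"
        using indep_iff[OF sub[OF X]] rk[OF X] card[OF X] by simp
      also have "\<dots> \<longleftrightarrow> (\<forall>S\<in>{S. S \<subseteq> ground N \<and> f ` S \<in> C}. S \<subseteq> X \<longrightarrow> S = {})"
        using X by (auto simp: subset_image_iff)
      finally show ?thesis .
    qed
  qed
qed

section \<open>Bases, closure and cyclic flats in terms of cycles\<close>

locale binary_matroid_cycles = binary_cycles +
  assumes rk_submodular: "X \<subseteq> ground M \<Longrightarrow> Y \<subseteq> ground M \<Longrightarrow>
    rk M (X \<union> Y) + rk M (X \<inter> Y) \<le> rk M X + rk M Y"
begin

lemma rk_insert_le: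
  assumes "X \<subseteq> ground M" "e \<in> ground M"
  shows "rk M (insert e X) \<le> rk M X + 1"
  using rk_submodular[of X "{e}"] rk_le_card[of "{e}"] assms by simp

lemma rk_insert_eq_mono:
  assumes "I \<subseteq> X" "X \<subseteq> ground M" "e \<in> ground M" and eq: "rk M (insert e I) = rk M I"
  shows "rk M (insert e X) = rk M X"
proof -
  have "rk M (X \<union> insert e I) + rk M (X \<inter> insert e I) \<le> rk M X + rk M (insert e I)"
    using assms by (intro rk_submodular) auto
  moreover have "rk M I \<le> rk M (X \<inter> insert e I)" using assms by (intro rk_mono) auto
  moreover have "X \<union> insert e I = insert e X" using assms by blast
  moreover have "rk M X \<le> rk M (insert e X)" using assms by (intro rk_mono) auto
  ultimately show ?thesis using eq by simp
qed

lemma rk_Un_eq: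
  assumes I: "I \<subseteq> ground M" and Y: "Y \<subseteq> ground M"
    and eq: "\<And>e. e \<in> Y \<Longrightarrow> rk M (insert e I) = rk M I"
  shows "rk M (I \<union> Y) = rk M I"
proof -
  have "finite Y" by (rule finite_subset_ground[OF Y])
  then show ?thesis using Y eq
  proof (induction Y)
    case (insert e Y)
    have "rk M (insert e (I \<union> Y)) = rk M (I \<union> Y)"
    proof (rule rk_insert_eq_mono[of I])
      show "rk M (insert e I) = rk M I" by (rule insert.prems(2)) simp
    qed (use insert.prems(1) I in simp_all)
    moreover have "rk M (I \<union> Y) = rk M I"
    proof (rule insert.IH)
      show "Y \<subseteq> ground M" using insert.prems(1) by simp
      show "rk M (insert x I) = rk M I" if "x \<in> Y" for x
        by (rule insert.prems(2)) (simp add: that)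
    qed
    ultimately show ?case by simp
  qed simp
qed

text \<open>A largest independent set between \<open>I\<close> and \<open>X\<close> spans
  \<open>X\<close>, since any element of \<open>X\<close> raising its rank could be added.\<close>

lemma basis_extension:
  assumes I: "I \<subseteq> X" "rk M I = card I" and X: "X \<subseteq> ground M"
  obtains B where "I \<subseteq> B" "B \<subseteq> X" "rk M B = card B" "card B = rk M X"
proof -
  define P where "P B \<longleftrightarrow> I \<subseteq> B \<and> B \<subseteq> X \<and> rk M B = card B" for B
  have "P I" using I by (simp add: P_def)
  moreover have "\<forall>B. P B \<longrightarrow> card B \<le> card X"
    using finite_subset_ground[OF X] by (auto simp: P_def intro: card_mono)
  ultimately obtain B where B: "P B" and max: "\<And>B'. P B' \<Longrightarrow> card B' \<le> card B"
    using ex_has_greatest_nat[of P I card "card X + 1"] by (metis le_imp_less_Suc Suc_eq_plus1)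
  have sub: "B \<subseteq> ground M" using B X by (auto simp: P_def)
  have "rk M (insert e B) = rk M B" if e: "e \<in> X" for e
  proof (rule ccontr)
    assume ne: "rk M (insert e B) \<noteq> rk M B"
    then have "e \<notin> B" by (auto simp: insert_absorb)
    then have "card (insert e B) = card B + 1" using finite_subset_ground[OF sub] by simp
    moreover have "rk M B \<le> rk M (insert e B)" using sub e X by (intro rk_mono) auto
    then have "rk M (insert e B) = rk M B + 1"
      using rk_insert_le[OF sub, of e] e X ne by auto
    ultimately have "P (insert e B)" using B e by (auto simp: P_def)
    then show False using max \<open>card (insert e B) = card B + 1\<close> by fastforce
  qed
  then have "rk M (B \<union> X) = rk M B" using sub X by (intro rk_Un_eq)
  moreover have "B \<union> X = X" using B by (auto simp: P_def)
  ultimately show thesis using B by (intro that[of B]) (auto simp: P_def)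
qed

text \<open>If \<open>e\<close> is spanned, adding it to a basis of \<open>X\<close> creates a
  cycle, which must pass through \<open>e\<close>. Conversely, a smallest cycle through
  \<open>e\<close> spans \<open>e\<close> by its other elements.\<close>

lemma rk_insert_eq_iff:
  assumes X: "X \<subseteq> ground M" and e: "e \<in> ground M" "e \<notin> X"
  shows "rk M (insert e X) = rk M X \<longleftrightarrow> (\<exists>S\<in>C. e \<in> S \<and> S \<subseteq> insert e X)"
proof
  assume eq: "rk M (insert e X) = rk M X"
  have "rk M {} = card ({} :: 'a set)" using rk_le_card[of "{}"] by simp
  then obtain B where B: "B \<subseteq> X" "rk M B = card B" "card B = rk M X"
    using basis_extension[of "{}" X] X by auto
  have sub: "insert e B \<subseteq> ground M" using B X e by blast
  have "rk M (insert e B) \<le> card B" using rk_mono[of "insert e B" "insert e X"] B X e eq by auto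
  moreover have "card (insert e B) = card B + 1"
    using B e sub finite_subset_ground[OF sub] by (subst card_insert_disjoint) auto
  ultimately have "rk M (insert e B) \<noteq> card (insert e B)" by simp
  then obtain S where S: "S \<in> C" "S \<subseteq> insert e B" "S \<noteq> {}" unfolding indep_iff[OF sub] by blast
  moreover have "e \<in> S"
  proof (rule ccontr)
    assume "e \<notin> S"
    then have "S \<subseteq> B" using S by blast
    then show False using indep_iff[of B] B S X by auto
  qed
  ultimately show "\<exists>S\<in>C. e \<in> S \<and> S \<subseteq> insert e X" using B by blast
next
  assume "\<exists>S\<in>C. e \<in> S \<and> S \<subseteq> insert e X"
  then obtain S0 where "S0 \<in> C \<and> e \<in> S0 \<and> S0 \<subseteq> insert e X" by blast
  from ex_has_least_nat[of "\<lambda>S. S \<in> C \<and> e \<in> S \<and> S \<subseteq> insert e X", OF this, of card]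
  obtain S where S: "S \<in> C \<and> e \<in> S \<and> S \<subseteq> insert e X"
    and min: "\<And>T. T \<in> C \<and> e \<in> T \<and> T \<subseteq> insert e X \<Longrightarrow> card S \<le> card T"
    by blast
  have sub: "S \<subseteq> ground M" "S - {e} \<subseteq> ground M" using S cycle_subset by blast+
  note fin = finite_subset_ground[OF sub(1)]
  \<comment> \<open>A nonempty cycle \<open>T\<close> avoiding \<open>e\<close> inside the smallest
    \<open>S\<close> could be cut out of it, leaving a smaller cycle through \<open>e\<close>. Hence
    \<open>S - {e}\<close> is independent.\<close>
  have "T = {}" if T: "T \<in> C" "T \<subseteq> S - {e}" for T
  proof (rule ccontr)
    assume "T \<noteq> {}"
    have "sym_diff S T \<in> C" using S T by (intro sym_diff_cycle) auto
    moreover have "sym_diff S T = S - T" using T by blast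
    ultimately have "card S \<le> card (S - T)" using S T by (intro min) auto
    moreover have "card (S - T) < card S" using T \<open>T \<noteq> {}\<close> fin by (intro psubset_card_mono) auto
    ultimately show False by simp
  qed
  then have "rk M (S - {e}) = card (S - {e})" using indep_iff[OF sub(2)] by blast
  moreover have "rk M S \<noteq> card S" using indep_iff[OF sub(1)] S by blast
  then have "rk M S < card S" using rk_le_card[OF sub(1)] by simp
  moreover have "card (S - {e}) = card S - 1" using S fin by simp
  moreover have "rk M (S - {e}) \<le> rk M S" using sub by (intro rk_mono) auto
  ultimately have "rk M (insert e (S - {e})) = rk M (S - {e})" using S by (simp add: insert_absorb)
  then show "rk M (insert e X) = rk M X"
    by (rule rk_insert_eq_mono[rotated 3]) (use S X e in blast)+
qed

lemma rk_Diff_eq_iff: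
  assumes X: "X \<subseteq> ground M" and e: "e \<in> X"
  shows "rk M (X - {e}) = rk M X \<longleftrightarrow> (\<exists>S\<in>C. e \<in> S \<and> S \<subseteq> X)"
proof -
  have "insert e (X - {e}) = X" using e by blast
  moreover have "X - {e} \<subseteq> ground M" "e \<in> ground M" "e \<notin> X - {e}" using X e by auto
  ultimately show ?thesis using rk_insert_eq_iff[of "X - {e}" e] by metis
qed

lemma cl_rk:
  assumes X: "X \<subseteq> ground M"
  shows "cl M X \<subseteq> ground M" "X \<subseteq> cl M X" "rk M (cl M X) = rk M X"
proof -
  show sub: "cl M X \<subseteq> ground M" by (auto simp: cl_def)
  show 1: "X \<subseteq> cl M X" using X by (auto simp: cl_def insert_absorb)
  have "rk M (X \<union> cl M X) = rk M X"
    using X sub by (rule rk_Un_eq) (simp add: cl_def)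
  then show "rk M (cl M X) = rk M X" using 1 by (simp add: Un_absorb1)
qed

text \<open>Closure preserves the rank, hence is idempotent, and each element that it adds lies on a
  cycle whose other elements are in \<open>X\<close>.\<close>

lemma cl_cyclic_flat:
  assumes X: "X \<subseteq> ground M" and cyclic: "\<And>e. e \<in> X \<Longrightarrow> \<exists>S\<in>C. e \<in> S \<and> S \<subseteq> X"
  shows "cl M X \<in> cyclic_flats M"
proof -
  note c = cl_rk[OF X]
  have "e \<in> cl M X" if "e \<in> cl M (cl M X)" for e
  proof -
    have e: "e \<in> ground M" "rk M (insert e (cl M X)) = rk M (cl M X)"
      using that by (simp_all add: cl_def[of M "cl M X"])
    have "rk M (insert e X) \<le> rk M X"
      using rk_mono[of "insert e X" "insert e (cl M X)"] c e by auto
    moreover have "rk M X \<le> rk M (insert e X)" using X e by (intro rk_mono) auto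
    ultimately show ?thesis using e by (simp add: cl_def)
  qed
  then have flat: "cl M (cl M X) = cl M X" using cl_rk(2)[OF c(1)] by blast
  have "\<exists>S\<in>C. e \<in> S \<and> S \<subseteq> cl M X" if e: "e \<in> cl M X" for e
  proof (cases "e \<in> X")
    case True
    then show ?thesis using cyclic[OF True] c(2) by blast
  next
    case False
    have "e \<in> ground M" "rk M (insert e X) = rk M X" using e by (simp_all add: cl_def)
    then obtain S where S: "S \<in> C" "e \<in> S" "S \<subseteq> insert e X"
      using rk_insert_eq_iff[OF X _ False] by blast
    then have "S \<subseteq> cl M X" using e c(2) by blast
    then show ?thesis using S by blast
  qed
  then have "cyc M (cl M X) = cl M X"
    using rk_Diff_eq_iff[OF c(1)] by (auto simp: cyc_def)
  then show ?thesis using flat c(1) by (simp add: cyclic_flats_def)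
qed

end

section \<open>The girth is at least the rank\<close>

context binary_matroid_cycles
begin

lemma rk_le_add_card_Diff:
  assumes X: "X \<subseteq> Y" and Y: "Y \<subseteq> ground M"
  shows "rk M Y \<le> rk M X + card (Y - X)"
proof -
  have "Y - X \<subseteq> ground M" "X \<subseteq> ground M" using X Y by auto
  then have "rk M (X \<union> (Y - X)) + rk M (X \<inter> (Y - X)) \<le> rk M X + rk M (Y - X)"
    by (intro rk_submodular)
  moreover have "rk M (Y - X) \<le> card (Y - X)" using \<open>Y - X \<subseteq> ground M\<close> by (rule rk_le_card)
  moreover have "X \<union> (Y - X) = Y" using X by blast
  ultimately show ?thesis by simp
qed

lemma fundamental_cycle:
  assumes B: "B \<subseteq> ground M" "rk M B = rk M (ground M)" and c: "c \<in> ground M - B"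
  obtains S where "S \<in> C" "c \<in> S" "S \<subseteq> insert c B"
proof -
  have "insert c B \<subseteq> ground M" using B c by blast
  then have "rk M (insert c B) \<le> rk M (ground M)" "rk M B \<le> rk M (insert c B)"
    by (blast intro: rk_mono)+
  then have "rk M (insert c B) = rk M B" using B by simp
  then show thesis using that rk_insert_eq_iff[OF B(1), of c] c by blast
qed

end

text \<open>
  The last assumption is what height 3 means in the presence of the cyclic flats \<open>\<emptyset>\<close> and \<open>E\<close>.
\<close>

locale flat_chain_free = binary_matroid_cycles +
  assumes three_le_cycle: "S \<in> C \<Longrightarrow> S \<noteq> {} \<Longrightarrow> 3 \<le> card S"
    and no_isthmus: "e \<in> ground M \<Longrightarrow> rk M (ground M - {e}) = rk M (ground M)"
    and no_chain: "A \<in> cyclic_flats M \<Longrightarrow> B \<in> cyclic_flats M \<Longrightarrow> A \<noteq> {} \<Longrightarrow> A \<subset> B \<Longrightarrow> B = ground M"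
begin

lemma proper_cyclic_flat_cycle:
  assumes Z: "Z \<in> cyclic_flats M" "Z \<noteq> {}"
  obtains S where "S \<in> C" "S \<noteq> {}" "S \<subseteq> Z"
proof -
  have sub: "Z \<subseteq> ground M" and cyc: "cyc M Z = Z" using Z by (auto simp: cyclic_flats_def)
  obtain e where e: "e \<in> Z" using Z by blast
  then have "e \<in> cyc M Z" unfolding cyc .
  then have "rk M (Z - {e}) = rk M Z" by (simp add: cyc_def)
  then show thesis using that rk_Diff_eq_iff[OF sub e] by blast
qed

text \<open>\<open>Z\<close> is dependent, so it has nullity at least 1. An element outside
  \<open>Z\<close> is no isthmus, so its deletion lowers the nullity by one, and the remaining set
  still contains \<open>Z\<close>.\<close>

lemma nullity_ge_two:
  assumes Z: "Z \<in> cyclic_flats M" "Z \<noteq> {}" "Z \<noteq> ground M"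
  shows "rk M (ground M) + 2 \<le> card (ground M)"
proof -
  have sub: "Z \<subseteq> ground M" using Z by (auto simp: cyclic_flats_def)
  obtain S where S: "S \<in> C" "S \<noteq> {}" "S \<subseteq> Z" using proper_cyclic_flat_cycle[OF Z(1,2)] .
  then have "rk M Z \<noteq> card Z" using indep_iff[OF sub] by blast
  then have Zlt: "rk M Z < card Z" using rk_le_card[OF sub] by simp
  obtain e where e: "e \<in> ground M" "e \<notin> Z" using Z sub by blast
  let ?Y = "ground M - {e}"
  have "rk M ?Y \<le> rk M Z + card (?Y - Z)"
    using sub e by (intro rk_le_add_card_Diff) auto
  moreover have "card (?Y - Z) = card ?Y - card Z"
    using sub e finite_subset_ground[OF sub] by (intro card_Diff_subset) auto
  moreover have "card Z \<le> card ?Y" using sub e finite_ground by (intro card_mono) auto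
  moreover have "card ?Y = card (ground M) - 1" using e finite_ground by simp
  moreover have "card ?Y < card (ground M)" using e finite_ground by (intro card_Diff1_less)
  ultimately show ?thesis using no_isthmus[OF e(1)] Zlt by linarith
qed

text \<open>Two elements of a cycle inside \<open>Z\<close> are independent because every nonempty
  cycle has at least three, and \<open>Z\<close> is a proper flat.\<close>

lemma rank_ge_three:
  assumes Z: "Z \<in> cyclic_flats M" "Z \<noteq> {}" "Z \<noteq> ground M"
  shows "3 \<le> rk M (ground M)"
proof -
  have sub: "Z \<subseteq> ground M" and cl: "cl M Z = Z" using Z by (auto simp: cyclic_flats_def)
  obtain S where S: "S \<in> C" "S \<noteq> {}" "S \<subseteq> Z" using proper_cyclic_flat_cycle[OF Z(1,2)] .
  then have "2 \<le> card S" using three_le_cycle[of S] by simp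
  then obtain T where T: "T \<subseteq> S" "card T = 2" using obtain_subset_with_card_n by metis
  have "T \<subseteq> ground M" using T S sub by blast
  then have "rk M T = card T"
    using three_le_cycle T by (intro indep_of_card_less[of 3]) simp_all
  moreover have "rk M T \<le> rk M Z" using T S sub by (intro rk_mono) auto
  ultimately have "2 \<le> rk M Z" using T by simp
  moreover obtain e where e: "e \<in> ground M" "e \<notin> Z" using Z sub by blast
  have "e \<notin> cl M Z" unfolding cl by (rule e(2))
  then have "rk M (insert e Z) \<noteq> rk M Z" using e by (simp add: cl_def)
  moreover have "rk M Z \<le> rk M (insert e Z)" "rk M (insert e Z) \<le> rk M (ground M)"
    using sub e by (auto intro!: rk_mono)
  ultimately show ?thesis by simp
qed

theorem rank_le_cycle:
  assumes null: "rk M (ground M) + 3 \<le> card (ground M)" and T0: "T0 \<in> C" "T0 \<noteq> {}"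
  shows "rk M (ground M) \<le> card T0"
proof (rule ccontr)
  let ?E = "ground M"
  let ?k = "rk M (ground M)"
  assume small: "\<not> ?k \<le> card T0"
  have "T0 \<in> C \<and> T0 \<noteq> {}" using T0 by simp
  from ex_has_least_nat[of "\<lambda>S. S \<in> C \<and> S \<noteq> {}", OF this, of card]
  obtain D where D: "D \<in> C" "D \<noteq> {}" and min: "\<And>S. S \<in> C \<Longrightarrow> S \<noteq> {} \<Longrightarrow> card D \<le> card S"
    by blast
  have D_lt: "card D < ?k" using min[OF T0] small by simp
  have D3: "3 \<le> card D" using three_le_cycle D by simp
  have sub: "D \<subseteq> ?E" using D cycle_subset by blast
  note finD = finite_subset_ground[OF sub]
  obtain x where x: "x \<in> D" using D by blast
  \<comment> \<open>By minimality of \<open>D\<close> the smaller set \<open>I\<close> is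
    independent, so \<open>D\<close> has rank \<open>card D - 1\<close>.\<close>
  define I where "I = D - {x}"
  have I: "I \<subseteq> D" "card I = card D - 1" "insert x I = D" "x \<notin> I" using x finD by (auto simp: I_def)
  have Isub: "I \<subseteq> ?E" using I sub by blast
  have rkI: "rk M I = card I"
    by (rule indep_of_card_less[of "card D"]) (use min Isub I(2) D3 in auto)
  have rkD: "rk M D = card D - 1"
  proof -
    have "rk M D \<noteq> card D" using indep_iff[OF sub] D by blast
    moreover have "rk M I \<le> rk M D" using I sub by (intro rk_mono)
    ultimately show ?thesis using rk_le_card[OF sub] rkI I(2) by linarith
  qed
  \<comment> \<open>\<open>D\<close> is closed: a cycle \<open>S\<close> through \<open>e\<close>
    inside \<open>insert e D\<close> and the sum of \<open>S\<close> and \<open>D\<close> would have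
    \<open>card D + 2\<close> elements in total, but each has at least
    \<open>card D \<ge> 3\<close>.\<close>
  have "e \<in> D" if e: "e \<in> cl M D" for e
  proof (rule ccontr)
    assume "e \<notin> D"
    have "e \<in> ?E" "rk M (insert e D) = rk M D" using e by (simp_all add: cl_def)
    then obtain S where S: "S \<in> C" "e \<in> S" "S \<subseteq> insert e D"
      using rk_insert_eq_iff[OF sub _ \<open>e \<notin> D\<close>] by blast
    have "sym_diff S D \<in> C" using S D by (intro sym_diff_cycle)
    moreover have sd: "sym_diff S D = insert e (D - S)" using S \<open>e \<notin> D\<close> by blast
    ultimately have "card D \<le> card (insert e (D - S))" by (intro min) auto
    moreover have "card (insert e (D - S)) = card (D - S) + 1"
      using finD \<open>e \<notin> D\<close> by simp
    moreover have "S = insert e (S \<inter> D)" using S by blast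
    then have "card S = card (insert e (S \<inter> D))" by (rule arg_cong)
    then have "card S = card (D \<inter> S) + 1" using finD \<open>e \<notin> D\<close> by (simp add: Int_commute)
    moreover have "card D \<le> card S" using S by (intro min) auto
    moreover have "card D = card (D \<inter> S) + card (D - S)" using finD by (rule card_Int_Diff)
    ultimately show False using D3 by linarith
  qed
  then have clD: "cl M D = D" using cl_rk(2)[OF sub] by blast
  have Dflat: "D \<in> cyclic_flats M"
    using cl_cyclic_flat[OF sub] D(1) unfolding clD by blast
  \<comment> \<open>The closure of \<open>D \<union> S\<close> is a cyclic flat above
    \<open>D\<close>, hence everything. As \<open>S\<close> is a cycle, one element of
    \<open>S - D\<close> can be spared, so \<open>D\<close> and the rest of \<open>S - D\<close>
    still span; this accounts for the 2.\<close>
  have ext: "?k + 2 \<le> card D + card (S - D)" if S: "S \<in> C" "\<not> S \<subseteq> D" for S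
  proof -
    let ?X = "D \<union> S"
    have X: "?X \<subseteq> ?E" using sub S cycle_subset by blast
    have "cl M ?X \<in> cyclic_flats M"
    proof (rule cl_cyclic_flat[OF X])
      show "\<exists>T\<in>C. e \<in> T \<and> T \<subseteq> ?X" if "e \<in> ?X" for e
        using that D(1) S(1) by blast
    qed
    moreover have "D \<subset> cl M ?X" using cl_rk(2)[OF X] S(2) by blast
    ultimately have "cl M ?X = ?E" using no_chain[OF Dflat] D(2) by blast
    then have rkX: "rk M ?X = ?k" using cl_rk(3)[OF X] by simp
    obtain t where t: "t \<in> S" "t \<notin> D" using S by blast
    have "rk M (?X - {t}) = rk M ?X" using rk_Diff_eq_iff[OF X, of t] S t by blast
    moreover have "rk M (?X - {t}) \<le> rk M D + card (?X - {t} - D)"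
      using X t by (intro rk_le_add_card_Diff) auto
    moreover have "card (?X - {t} - D) = card (S - D - {t})"
      by (rule arg_cong[where f = card]) blast
    moreover have "finite (S - D)" using S cycle_subset finite_subset_ground by blast
    then have "card (S - D - {t}) = card (S - D) - 1" "0 < card (S - D)"
      using t by (auto simp: card_gt_0_iff)
    ultimately show ?thesis using rkX rkD D3 by linarith
  qed
  \<comment> \<open>A basis of \<open>M\<close> that extends \<open>I\<close>; then
    \<open>B - D\<close> is a basis of the contraction by \<open>D\<close>.\<close>
  obtain B where B: "I \<subseteq> B" "B \<subseteq> ?E" "rk M B = card B" "card B = ?k"
    using basis_extension[OF Isub rkI order_refl] .
  note finB = finite_subset_ground[OF B(2)]
  have "x \<notin> B"
  proof
    assume "x \<in> B"
    then have "D \<subseteq> B" using B(1) I(3) by blast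
    then show False using indep_iff[OF B(2)] B(3) D by blast
  qed
  then have BD: "B \<inter> D = I" using B(1) I(3) by blast
  have cardBD: "card (B - D) = ?k + 1 - card D"
  proof -
    have "card B = card (B \<inter> D) + card (B - D)" using finB by (rule card_Int_Diff)
    then show ?thesis using B(4) I(2) D3 D_lt unfolding BD by linarith
  qed
  \<comment> \<open>Besides \<open>x\<close>, which depends on \<open>I\<close>, nullity 3 leaves
    two more elements outside the basis.\<close>
  let ?R = "?E - (insert x B)"
  have "card (insert x B) = ?k + 1" using finB \<open>x \<notin> B\<close> B(4) by simp
  moreover have "card ?R = card ?E - card (insert x B)"
    using finB B(2) x sub by (intro card_Diff_subset) auto
  ultimately have "2 \<le> card ?R" using null by linarith
  then obtain e f where ef: "e \<in> ?R" "f \<in> ?R" "e \<noteq> f" by (rule two_le_card_obtain)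
  \<comment> \<open>By \<open>ext\<close>, the fundamental cycle of \<open>c\<close> is so large
    outside \<open>D\<close> that it must contain all of \<open>B - D\<close>.\<close>
  have fund: "\<exists>S\<in>C. S - D = insert c (B - D)" if c: "c \<in> ?R" for c
  proof -
    have cD: "c \<notin> D" using c B(1) I(3) by blast
    obtain S where S: "S \<in> C" "c \<in> S" "S \<subseteq> insert c B"
      using fundamental_cycle[OF B(2), of c] B(3,4) c by auto
    have "card (insert c (B - D)) = ?k + 2 - card D"
      using cardBD c finB D_lt by simp
    moreover have "?k + 2 \<le> card D + card (S - D)" using S cD by (intro ext) auto
    moreover have "S - D \<subseteq> insert c (B - D)" using S by blast
    moreover have "finite (insert c (B - D))" using finB by simp
    ultimately have "S - D = insert c (B - D)" by (intro card_seteq) linarith+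
    then show ?thesis using S by blast
  qed
  obtain S T where S: "S \<in> C" "S - D = insert e (B - D)" and T: "T \<in> C" "T - D = insert f (B - D)"
    using fund[OF ef(1)] fund[OF ef(2)] by blast
  \<comment> \<open>In the sum \<open>B - D\<close> cancels and only two elements outside
    \<open>D\<close> remain, fewer than \<open>ext\<close> demands.\<close>
  have "sym_diff S T - D = sym_diff (S - D) (T - D)" by blast
  also have "\<dots> = {e, f}" unfolding S(2) T(2) using ef by blast
  finally have sd: "sym_diff S T - D = {e, f}" .
  then have "?k + 2 \<le> card D + card (sym_diff S T - D)"
    by (intro ext sym_diff_cycle S T) blast
  then show False unfolding sd using D_lt ef(3) by simp
qed

end

section \<open>Matroids from fundamental cycles\<close>

text \<open>The subspace over F_2 generated by the listed sets, each set standing for its indicator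
  vector. The recursion allows evaluation on concrete lists.\<close>

fun cycle_span :: "'a set list \<Rightarrow> 'a set set" where
  "cycle_span [] = {{}}"
| "cycle_span (g # gs) = cycle_span gs \<union> sym_diff g ` cycle_span gs"

text \<open>The two claims are proved together: \<open>f\<close> is injective only on
  \<open>E\<close>, so it respects symmetric differences only once the sets are known to lie in
  \<open>E\<close>.\<close>

lemma cycle_span_image:
  assumes "inj_on f E" "\<And>g. g \<in> set gs \<Longrightarrow> g \<subseteq> E"
  shows "cycle_span (map ((`) f) gs) = (`) f ` cycle_span gs"
    and "\<And>S. S \<in> cycle_span gs \<Longrightarrow> S \<subseteq> E"
  using assms(2)
proof (induction gs)
  case (Cons g gs)
  { case 1
    have g: "g \<subseteq> E" using 1 by simp
    have IH: "cycle_span (map ((`) f) gs) = (`) f ` cycle_span gs"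
      by (rule Cons(1)) (simp add: 1)
    have "f ` sym_diff g S = sym_diff (f ` g) (f ` S)" if "S \<in> cycle_span gs" for S
    proof -
      have "S \<subseteq> E" using Cons(2)[OF that] 1 by simp
      then show ?thesis using inj_on_image_set_diff[OF assms(1)] g by (simp add: image_Un Diff_subset le_supI1 subset_trans[OF Diff_subset])
    qed
    then show ?case using IH by (simp add: image_Un image_image) }
  { case 2
    then show ?case using Cons(2) by (auto simp del: UN_simps) }
qed simp_all

text \<open>Adding the fundamental cycles of the elements of a cycle outside \<open>B\<close> leaves
  a cycle inside \<open>B\<close>, which is empty. So every cycle is a sum of generators.\<close>

lemma (in binary_cycles) eq_cycle_span:
  assumes indep: "\<And>S. S \<in> C \<Longrightarrow> S \<subseteq> B \<Longrightarrow> S = {}"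
    and gens: "\<And>c g. (c, g) \<in> set ps \<Longrightarrow> g \<in> C \<and> g \<inter> (ground M - B) = {c}"
    and all: "ground M - B = fst ` set ps"
  shows "C = cycle_span (map snd ps)"
proof
  \<comment> \<open>Generalised to sublists for the induction: \<open>S\<close> may use only those
    elements outside \<open>B\<close> that the list \<open>qs\<close> can still eliminate.\<close>
  have "S \<in> cycle_span (map snd qs)"
    if "set qs \<subseteq> set ps" "S \<in> C" "S \<inter> (ground M - B) \<subseteq> fst ` set qs" for S qs
    using that
  proof (induction qs arbitrary: S)
    case Nil
    have "S \<subseteq> ground M" using Nil by (intro cycle_subset)
    then have "S = {}" using Nil by (intro indep) auto
    then show ?case by simp
  next
    case (Cons q qs)
    obtain c g where q: "q = (c, g)" by (cases q)
    have g: "g \<in> C" "g \<inter> (ground M - B) = {c}" using gens Cons.prems(1) q by auto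
    have qs: "set qs \<subseteq> set ps" using Cons.prems(1) by simp
    show ?case
    proof (cases "c \<in> S")
      case True
      have "sym_diff g S \<inter> (ground M - B) \<subseteq> fst ` set qs"
        using Cons.prems(3) g(2) True unfolding q by auto
      then have "sym_diff g S \<in> cycle_span (map snd qs)"
        using Cons.IH[OF qs] sym_diff_cycle[OF g(1) Cons.prems(2)] by blast
      then have "sym_diff g (sym_diff g S) \<in> sym_diff g ` cycle_span (map snd qs)"
        by (rule imageI)
      then show ?thesis unfolding sym_diff_cancel q by simp
    next
      case False
      have "S \<inter> (ground M - B) \<subseteq> fst ` set qs"
        using Cons.prems(3) False unfolding q by auto
      then show ?thesis using Cons.IH[OF qs Cons.prems(2)] by simp
    qed
  qed
  then show "C \<subseteq> cycle_span (map snd ps)" using all by blast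
  have "cycle_span gs \<subseteq> C" if "set gs \<subseteq> C" for gs
    using that
  proof (induction gs)
    case (Cons g gs)
    then have g: "g \<in> C" and IH: "cycle_span gs \<subseteq> C" by simp_all
    have "sym_diff g ` cycle_span gs \<subseteq> C" using IH g sym_diff_cycle by blast
    then show ?case using IH by simp
  qed (simp add: empty_cycle)
  moreover have "set (map snd ps) \<subseteq> C" using gens by auto
  ultimately show "cycle_span (map snd ps) \<subseteq> C" by blast
qed

lemma matroid_iso_sym:
  assumes "matroid_iso M N"
  shows "matroid_iso N M"
proof -
  obtain f where f: "bij_betw f (ground M) (ground N)"
    and rk: "\<And>X. X \<subseteq> ground M \<Longrightarrow> rk N (f ` X) = rk M X"
    using assms unfolding matroid_iso_def by blast
  define g where "g = inv_into (ground M) f"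
  have g: "bij_betw g (ground N) (ground M)"
    unfolding g_def by (rule bij_betw_inv_into[OF f])
  have "rk M (g ` X) = rk N X" if X: "X \<subseteq> ground N" for X
  proof -
    have "f ` g ` X = X"
      unfolding g_def using f X by (intro image_inv_into_cancel) (auto simp: bij_betw_def)
    moreover have "g ` X \<subseteq> ground M" using g X by (auto simp: bij_betw_def)
    ultimately show ?thesis using rk by metis
  qed
  then show ?thesis using g unfolding matroid_iso_def by blast
qed

text \<open>By \<open>eq_cycle_span\<close> the images of the generators generate \<open>C\<close>,
  so \<open>e\<close> carries the circuit-hyperplanes of \<open>N\<close> onto those of
  \<open>M\<close>. The map runs from \<open>N\<close> to \<open>M\<close> because the generators
  are given on the concrete side.\<close>

lemma (in binary_cycles) matroid_iso_of_generators:
  assumes M: "sparse_paving M k {S \<in> C. card S = k}"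
    and N: "sparse_paving N k {S \<in> cycle_span (map snd ps). card S = k}"
    and e: "bij_betw e (ground N) (ground M)"
    and B: "B \<subseteq> ground N" "\<And>S. S \<in> C \<Longrightarrow> S \<subseteq> e ` B \<Longrightarrow> S = {}"
    and gens: "\<And>c g. (c, g) \<in> set ps \<Longrightarrow> g \<subseteq> ground N \<and> e ` g \<in> C \<and> g \<inter> (ground N - B) = {c}"
    and all: "ground N - B = fst ` set ps"
  shows "matroid_iso M N"
proof -
  have inj: "inj_on e (ground N)" and im: "e ` ground N = ground M"
    using e by (auto simp: bij_betw_def)
  have eB: "ground M - e ` B = e ` (ground N - B)"
    using inj_on_image_set_diff[OF inj _ B(1)] im by simp
  have sub: "g \<subseteq> ground N" if g: "g \<in> set (map snd ps)" for g
  proof -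
    obtain c where "(c, g) \<in> set ps" using g by auto
    then show ?thesis using gens by blast
  qed
  have "C = cycle_span (map snd (map (\<lambda>(c, g). (e c, e ` g)) ps))"
  proof (rule eq_cycle_span[OF B(2)])
    fix c g assume "(c, g) \<in> set (map (\<lambda>(c, g). (e c, e ` g)) ps)"
    then obtain c' g' where p: "(c', g') \<in> set ps" "c = e c'" "g = e ` g'" by auto
    then have g': "g' \<subseteq> ground N" "e ` g' \<in> C" "g' \<inter> (ground N - B) = {c'}"
      using gens by blast+
    have "g \<inter> (ground M - e ` B) = e ` (g' \<inter> (ground N - B))"
      unfolding eB p using g'(1) by (intro inj_on_image_Int[OF inj, symmetric]) auto
    then show "g \<in> C \<and> g \<inter> (ground M - e ` B) = {c}" using g' p by simp
  next
    show "ground M - e ` B = fst ` set (map (\<lambda>(c, g). (e c, e ` g)) ps)"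
      unfolding eB all by force
  qed
  also have "map snd (map (\<lambda>(c, g). (e c, e ` g)) ps) = map ((`) e) (map snd ps)" by auto
  also note cycle_span_image(1)[OF inj sub]
  finally have C: "C = (`) e ` cycle_span (map snd ps)" .
  have span: "S \<subseteq> ground N" if "S \<in> cycle_span (map snd ps)" for S
    using cycle_span_image(2)[OF inj sub that] .
  have "matroid_iso N M"
  proof (rule matroid_iso_sparse_paving[OF N M e])
    fix X assume X: "X \<subseteq> ground N"
    have "card (e ` X) = card X" using X inj by (meson card_image inj_on_subset)
    moreover have "e ` X \<in> C \<longleftrightarrow> X \<in> cycle_span (map snd ps)"
    proof
      assume "e ` X \<in> C"
      then have "e ` X \<in> (`) e ` cycle_span (map snd ps)" unfolding C .
      then obtain S where S: "S \<in> cycle_span (map snd ps)" "e ` X = e ` S" by (rule imageE)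
      have "X = S" using S(2) inj_on_image_eq_iff[OF inj X span[OF S(1)]] by simp
      then show "X \<in> cycle_span (map snd ps)" using S(1) by simp
    qed (simp add: C)
    ultimately show "e ` X \<in> {S \<in> C. card S = k} \<longleftrightarrow> X \<in> {S \<in> cycle_span (map snd ps). card S = k}"
      by simp
  qed
  then show ?thesis by (rule matroid_iso_sym)
qed

section \<open>The exceptional matroids\<close>

text \<open>The bijection is given as a list: \<open>xs ! i\<close> is the element of
  \<open>M\<close> matched with the element \<open>i\<close> of \<open>N\<close>.\<close>

lemma (in binary_cycles) matroid_iso_of_enumeration:
  assumes M: "sparse_paving M k {S \<in> C. card S = k}"
    and N: "sparse_paving N k {S \<in> cycle_span (map snd ps). card S = k}"
    and ground: "ground N = {..<length xs}"
    and xs: "distinct xs" "set xs = ground M"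
    and B: "B \<subseteq> {..<length xs}" "\<And>S. S \<in> C \<Longrightarrow> S \<subseteq> (!) xs ` B \<Longrightarrow> S = {}"
    and reps: "\<forall>(c, g)\<in>set ps. g \<subseteq> {..<length xs} \<and> g \<inter> ({..<length xs} - B) = {c}"
    and all: "{..<length xs} - B = fst ` set ps"
    and gens: "\<forall>g\<in>snd ` set ps. (!) xs ` g \<in> C"
  shows "matroid_iso M N"
proof (rule matroid_iso_of_generators[OF M N])
  show "bij_betw ((!) xs) (ground N) (ground M)"
    using xs ground by (intro bij_betw_nth) auto
  show "g \<subseteq> ground N \<and> (!) xs ` g \<in> C \<and> g \<inter> (ground N - B) = {c}" if "(c, g) \<in> set ps" for c g
    using bspec[OF reps that] bspec[OF gens, of g] that unfolding ground by force
qed (use B all ground in auto)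

text \<open>Reduces the claim for a concrete matrix to finite checks: the listed fundamental cycles
  generate all zero-sum sets, and the girth condition is tested on their span.\<close>

lemma sparse_paving_column_matroid:
  assumes k: "dim_row A = k" "3 \<le> k" "k + 2 \<le> dim_col A"
    and indep: "\<And>S. S \<in> zero_sums A \<Longrightarrow> S \<subseteq> B \<Longrightarrow> S = {}"
    and reps: "\<forall>(c, g)\<in>set ps. g \<subseteq> {..<dim_col A} \<and> g \<inter> ({..<dim_col A} - B) = {c}"
    and all: "{..<dim_col A} - B = fst ` set ps"
    and gens: "\<forall>g\<in>snd ` set ps. g \<in> zero_sums A"
    and girth: "\<forall>S\<in>cycle_span (map snd ps). S = {} \<or> k \<le> card S"
  shows "sparse_paving (column_matroid A) k {S \<in> cycle_span (map snd ps). card S = k}"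
proof -
  interpret binary_cycles "column_matroid A" "zero_sums A"
    by (rule binary_cycles_column_matroid)
  have zs: "zero_sums A = cycle_span (map snd ps)"
  proof (rule eq_cycle_span[OF indep])
    show "g \<in> zero_sums A \<and> g \<inter> (ground (column_matroid A) - B) = {c}" if "(c, g) \<in> set ps" for c g
      using bspec[OF reps that] bspec[OF gens, of g] that by force
  qed (use all in simp_all)
  show ?thesis unfolding zs[symmetric]
  proof (rule sparse_paving_of_girth)
    show "k \<le> card S" if "S \<in> zero_sums A" "S \<noteq> {}" for S using girth that unfolding zs by blast
    show "rk (column_matroid A) (ground (column_matroid A)) \<le> k"
      using rk_column_matroid_le_dim_row[of "{..<dim_col A}" A] k by simp
  qed (use k in simp_all)
qed

text \<open>
  An entry \<open>(c, g)\<close> consists of an element outside a fixed basis and its fundamental cycle. The list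
  \<open>gens_a'\<close> belongs to another basis of the first matroid, for which no fundamental cycle contains the
  whole basis.
\<close>

abbreviation gens_a :: "(nat \<times> nat set) list" where
  "gens_a \<equiv> [(3, {0,1,3}), (4, {0,2,4}), (5, {0,1,2,5})]"

abbreviation gens_a' :: "(nat \<times> nat set) list" where
  "gens_a' \<equiv> [(0, {0,2,4}), (1, {1,4,5}), (3, {2,3,5})]"

abbreviation gens_b :: "(nat \<times> nat set) list" where
  "gens_b \<equiv> [(2, {0,1,2}), (4, {0,3,4}), (5, {1,3,5}), (6, {0,1,3,6})]"

text \<open>The complements of the lines \<open>{1,3,5}\<close>, \<open>{0,3,4}\<close> and
  \<open>{0,1,2}\<close> of the Fano plane.\<close>

abbreviation gens_c :: "(nat \<times> nat set) list" where
  "gens_c \<equiv> [(0, {0,2,4,6}), (1, {1,2,5,6}), (3, {3,4,5,6})]"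

abbreviation gens_d :: "(nat \<times> nat set) list" where
  "gens_d \<equiv> [(4, {0,1,2,4}), (5, {1,2,3,5}), (6, {0,2,3,6}), (7, {0,1,3,7})]"

lemma reps_a: "\<forall>(c, g)\<in>set gens_a. g \<subseteq> {..<6} \<and> g \<inter> ({..<6} - {0,1,2}) = {c}"
    "{..<6} - {0,1,2} = fst ` set gens_a"
  by code_simp+

lemma reps_a': "\<forall>(c, g)\<in>set gens_a'. g \<subseteq> {..<6} \<and> g \<inter> ({..<6} - {2,4,5}) = {c}"
    "{..<6} - {2,4,5} = fst ` set gens_a'"
  by code_simp+

lemma reps_b: "\<forall>(c, g)\<in>set gens_b. g \<subseteq> {..<7} \<and> g \<inter> ({..<7} - {0,1,3}) = {c}"
    "{..<7} - {0,1,3} = fst ` set gens_b"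
  by code_simp+

lemma reps_c: "\<forall>(c, g)\<in>set gens_c. g \<subseteq> {..<7} \<and> g \<inter> ({..<7} - {2,4,5,6}) = {c}"
    "{..<7} - {2,4,5,6} = fst ` set gens_c"
  by code_simp+

lemma reps_d: "\<forall>(c, g)\<in>set gens_d. g \<subseteq> {..<8} \<and> g \<inter> ({..<8} - {0,1,2,3}) = {c}"
    "{..<8} - {0,1,2,3} = fst ` set gens_d"
  by code_simp+

lemma cycle_span_a': "cycle_span (map snd gens_a') = cycle_span (map snd gens_a)"
  by code_simp

lemma sparse_paving_a: "sparse_paving matroid_a 3 {S \<in> cycle_span (map snd gens_a). card S = 3}"
  unfolding matroid_a_def
proof (rule sparse_paving_column_matroid)
  let ?A = "mat_of_rows_list 6
     [[1, 0, 0, 1, 1, 1],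
      [0, 1, 0, 1, 0, 1],
      [0, 0, 1, 0, 1, 1]] :: bit mat"
  have dim: "dim_row ?A = 3" "dim_col ?A = 6" by (simp_all add: mat_of_rows_list_def)
  then show "dim_row ?A = 3" "3 + 2 \<le> dim_col ?A" by simp_all
  show "S = {}" if "S \<in> zero_sums ?A" "S \<subseteq> {0,1,2}" for S
  proof -
    have "S \<in> Pow {0,1,2}" using that by simp
    then show ?thesis using that(1)
      by (simp only: Pow_insert Pow_empty image_insert image_empty Un_insert_left Un_empty_left insert_iff empty_iff simp_thms)
        (elim disjE; simp add: zero_sums_def All_less_Suc mat_of_rows_list_def)
  qed
  show "\<forall>g\<in>snd ` set gens_a. g \<in> zero_sums ?A"
    by (simp add: zero_sums_def All_less_Suc mat_of_rows_list_def)
  show "\<forall>(c, g)\<in>set gens_a. g \<subseteq> {..<dim_col ?A} \<and> g \<inter> ({..<dim_col ?A} - {0,1,2}) = {c}"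
    "{..<dim_col ?A} - {0,1,2} = fst ` set gens_a"
    unfolding dim by (rule reps_a)+
  show "\<forall>S\<in>cycle_span (map snd gens_a). S = {} \<or> 3 \<le> card S" by code_simp
qed simp

lemma sparse_paving_b: "sparse_paving matroid_b 3 {S \<in> cycle_span (map snd gens_b). card S = 3}"
  unfolding matroid_b_def
proof (rule sparse_paving_column_matroid)
  let ?A = "mat_of_rows_list 7
     [[1, 0, 1, 0, 1, 0, 1],
      [0, 1, 1, 0, 0, 1, 1],
      [0, 0, 0, 1, 1, 1, 1]] :: bit mat"
  have dim: "dim_row ?A = 3" "dim_col ?A = 7" by (simp_all add: mat_of_rows_list_def)
  then show "dim_row ?A = 3" "3 + 2 \<le> dim_col ?A" by simp_all
  \<comment> \<open>Columns 0, 1 and 3 are the numbers 1, 2 and 4 in binary, that is, the unit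
    vectors.\<close>
  show "S = {}" if "S \<in> zero_sums ?A" "S \<subseteq> {0,1,3}" for S
  proof -
    have "S \<in> Pow {0,1,3}" using that by simp
    then show ?thesis using that(1)
      by (simp only: Pow_insert Pow_empty image_insert image_empty Un_insert_left Un_empty_left insert_iff empty_iff simp_thms)
        (elim disjE; simp add: zero_sums_def All_less_Suc mat_of_rows_list_def)
  qed
  show "\<forall>g\<in>snd ` set gens_b. g \<in> zero_sums ?A"
    by (simp add: zero_sums_def All_less_Suc mat_of_rows_list_def)
  show "\<forall>(c, g)\<in>set gens_b. g \<subseteq> {..<dim_col ?A} \<and> g \<inter> ({..<dim_col ?A} - {0,1,3}) = {c}"
    "{..<dim_col ?A} - {0,1,3} = fst ` set gens_b"
    unfolding dim by (rule reps_b)+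
  show "\<forall>S\<in>cycle_span (map snd gens_b). S = {} \<or> 3 \<le> card S" by code_simp
qed simp

lemma sparse_paving_d: "sparse_paving matroid_d 4 {S \<in> cycle_span (map snd gens_d). card S = 4}"
  unfolding matroid_d_def
proof (rule sparse_paving_column_matroid)
  let ?A = "mat_of_rows_list 8
     [[1, 0, 0, 0, 1, 0, 1, 1],
      [0, 1, 0, 0, 1, 1, 0, 1],
      [0, 0, 1, 0, 1, 1, 1, 0],
      [0, 0, 0, 1, 0, 1, 1, 1]] :: bit mat"
  have dim: "dim_row ?A = 4" "dim_col ?A = 8" by (simp_all add: mat_of_rows_list_def)
  then show "dim_row ?A = 4" "4 + 2 \<le> dim_col ?A" by simp_all
  show "S = {}" if "S \<in> zero_sums ?A" "S \<subseteq> {0,1,2,3}" for S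
  proof -
    have "S \<in> Pow {0,1,2,3}" using that by simp
    then show ?thesis using that(1)
      by (simp only: Pow_insert Pow_empty image_insert image_empty Un_insert_left Un_empty_left insert_iff empty_iff simp_thms)
        (elim disjE; simp add: zero_sums_def All_less_Suc mat_of_rows_list_def)
  qed
  show "\<forall>g\<in>snd ` set gens_d. g \<in> zero_sums ?A"
    by (simp add: zero_sums_def All_less_Suc mat_of_rows_list_def)
  show "\<forall>(c, g)\<in>set gens_d. g \<subseteq> {..<dim_col ?A} \<and> g \<inter> ({..<dim_col ?A} - {0,1,2,3}) = {c}"
    "{..<dim_col ?A} - {0,1,2,3} = fst ` set gens_d"
    unfolding dim by (rule reps_d)+
  show "\<forall>S\<in>cycle_span (map snd gens_d). S = {} \<or> 4 \<le> card S" by code_simp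
qed simp

section \<open>The dual of the Fano matroid and the parameters of the exceptional matroids\<close>

lemma ground_exceptional:
  "ground matroid_a = {..<6}" "ground matroid_b = {..<7}" "ground matroid_c = {..<7}" "ground matroid_d = {..<8}"
  by (simp_all add: matroid_a_def matroid_b_def matroid_c_def matroid_d_def matroid_dual_def mat_of_rows_list_def)

lemma complement_b:
  "(\<lambda>X. {..<7} - X) ` {S \<in> cycle_span (map snd gens_b). card S = 3} = {S \<in> cycle_span (map snd gens_c). card S = 4}"
  by code_simp

text \<open>No matrix is involved here: the circuit-hyperplanes are obtained by duality as the
  complements of the Fano lines.\<close>

lemma sparse_paving_c: "sparse_paving matroid_c 4 {S \<in> cycle_span (map snd gens_c). card S = 4}"
  using sparse_paving.dual[OF sparse_paving_b]
  unfolding matroid_c_def[symmetric] ground_exceptional complement_b by simp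

lemma card_hyperplanes:
  "card {S \<in> cycle_span (map snd gens_a). card S = 3} = 4"
  "card {S \<in> cycle_span (map snd gens_b). card S = 3} = 7"
  "card {S \<in> cycle_span (map snd gens_c). card S = 4} = 7"
  "card {S \<in> cycle_span (map snd gens_d). card S = 4} = 14"
  by code_simp+

lemma exceptional_parameters:
  assumes "sparse_paving N k H" "ground N = {..<n}" "card H = h" "0 < h"
  shows "nkd_matroid N n k (n - k)" "card (atoms (cyclic_flats N)) = h"
proof -
  have "H \<noteq> {}" using assms(3,4) by auto
  then show "nkd_matroid N n k (n - k)" "card (atoms (cyclic_flats N)) = h"
    using sparse_paving.nkd_matroid[OF assms(1)] sparse_paving.atoms[OF assms(1)] assms(2,3) by simp_all
qed

section \<open>Recognising the exceptional matroids by fundamental cycles\<close>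

context binary_cycles
begin

text \<open>Here and in the following lemmas the \<open>b\<close>s form a basis. The fundamental
  cycle of \<open>c1\<close>, \<open>c2\<close>, \<open>c3\<close> or \<open>c4\<close> misses just
  the \<open>b\<close> of the same index, and that of \<open>c0\<close> contains the whole
  basis.\<close>

lemma matroid_iso_a:
  assumes sp: "sparse_paving M 3 {S \<in> C. card S = 3}"
    and d: "distinct [b1,b2,b3,c0,c1,c2]" and ground: "ground M = {b1,b2,b3,c0,c1,c2}"
    and B: "\<And>S. S \<in> C \<Longrightarrow> S \<subseteq> {b1,b2,b3} \<Longrightarrow> S = {}"
    and z: "insert c0 {b1,b2,b3} \<in> C" "insert c1 ({b1,b2,b3} - {b1}) \<in> C" "insert c2 ({b1,b2,b3} - {b2}) \<in> C"
  shows "matroid_iso M matroid_a"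
proof -
  \<comment> \<open>The order is chosen so that the generators become the given cycles;
    \<open>b3\<close>, which lies in all three of them, goes to position 0.\<close>
  let ?xs = "[b3,b2,b1,c1,c2,c0]"
  have eqs: "insert c0 {b1,b2,b3} = {b3,b2,b1,c0}" "insert c1 ({b1,b2,b3} - {b1}) = {b3,b2,c1}" "insert c2 ({b1,b2,b3} - {b2}) = {b3,b1,c2}"
    using d by auto
  note cycles = z[unfolded eqs]
  have len: "length ?xs = 6" by simp
  have B_eq: "(!) ?xs ` {0,1,2} = {b1,b2,b3}" by auto
  show ?thesis
  proof (rule matroid_iso_of_enumeration[OF sp sparse_paving_a, where xs = ?xs and B = "{0,1,2}"])
    show "distinct ?xs" using d by auto
    show "set ?xs = ground M" unfolding ground by auto
    show "S = {}" if "S \<in> C" "S \<subseteq> (!) ?xs ` {0,1,2}" for S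
      using B that unfolding B_eq .
    show "\<forall>g\<in>snd ` set gens_a. (!) ?xs ` g \<in> C" using cycles by simp
  qed (unfold len, (rule ground_exceptional reps_a | simp)+)
qed

text \<open>The same matroid seen from a basis contained in no fundamental cycle, which is matched
  with the basis \<open>{2,4,5}\<close> of \<open>matroid_a\<close>.\<close>

lemma matroid_iso_a':
  assumes sp: "sparse_paving M 3 {S \<in> C. card S = 3}"
    and d: "distinct [b1,b2,b3,c1,c2,c3]" and ground: "ground M = {b1,b2,b3,c1,c2,c3}"
    and B: "\<And>S. S \<in> C \<Longrightarrow> S \<subseteq> {b1,b2,b3} \<Longrightarrow> S = {}"
    and z: "insert c1 ({b1,b2,b3} - {b1}) \<in> C" "insert c2 ({b1,b2,b3} - {b2}) \<in> C" "insert c3 ({b1,b2,b3} - {b3}) \<in> C"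
  shows "matroid_iso M matroid_a"
proof -
  let ?xs = "[c1,c2,b2,c3,b3,b1]"
  have eqs: "insert c1 ({b1,b2,b3} - {b1}) = {c1,b2,b3}" "insert c2 ({b1,b2,b3} - {b2}) = {c2,b3,b1}" "insert c3 ({b1,b2,b3} - {b3}) = {b2,c3,b1}"
    using d by auto
  note cycles = z[unfolded eqs]
  have len: "length ?xs = 6" by simp
  have B_eq: "(!) ?xs ` {2,4,5} = {b1,b2,b3}" by auto
  show ?thesis
  proof (rule matroid_iso_of_enumeration[OF sp sparse_paving_a[folded cycle_span_a'], where xs = ?xs and B = "{2,4,5}"])
    show "distinct ?xs" using d by auto
    show "set ?xs = ground M" unfolding ground by auto
    show "S = {}" if "S \<in> C" "S \<subseteq> (!) ?xs ` {2,4,5}" for S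
      using B that unfolding B_eq .
    show "\<forall>g\<in>snd ` set gens_a'. (!) ?xs ` g \<in> C" using cycles by simp
  qed (unfold len, (rule ground_exceptional reps_a' | simp)+)
qed

lemma matroid_iso_b:
  assumes sp: "sparse_paving M 3 {S \<in> C. card S = 3}"
    and d: "distinct [b1,b2,b3,c0,c1,c2,c3]" and ground: "ground M = {b1,b2,b3,c0,c1,c2,c3}"
    and B: "\<And>S. S \<in> C \<Longrightarrow> S \<subseteq> {b1,b2,b3} \<Longrightarrow> S = {}"
    and z: "insert c0 {b1,b2,b3} \<in> C" "insert c1 ({b1,b2,b3} - {b1}) \<in> C" "insert c2 ({b1,b2,b3} - {b2}) \<in> C" "insert c3 ({b1,b2,b3} - {b3}) \<in> C"
  shows "matroid_iso M matroid_b"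
proof -
  let ?xs = "[b3,b2,c1,b1,c2,c3,c0]"
  have eqs: "insert c0 {b1,b2,b3} = {b3,b2,b1,c0}" "insert c1 ({b1,b2,b3} - {b1}) = {b3,b2,c1}" "insert c2 ({b1,b2,b3} - {b2}) = {b3,b1,c2}" "insert c3 ({b1,b2,b3} - {b3}) = {b2,b1,c3}"
    using d by auto
  note cycles = z[unfolded eqs]
  have len: "length ?xs = 7" by simp
  have B_eq: "(!) ?xs ` {0,1,3} = {b1,b2,b3}" by auto
  show ?thesis
  proof (rule matroid_iso_of_enumeration[OF sp sparse_paving_b, where xs = ?xs and B = "{0,1,3}"])
    show "distinct ?xs" using d by auto
    show "set ?xs = ground M" unfolding ground by auto
    show "S = {}" if "S \<in> C" "S \<subseteq> (!) ?xs ` {0,1,3}" for S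
      using B that unfolding B_eq .
    show "\<forall>g\<in>snd ` set gens_b. (!) ?xs ` g \<in> C" using cycles by simp
  qed (unfold len, (rule ground_exceptional reps_b | simp)+)
qed

lemma matroid_iso_c:
  assumes sp: "sparse_paving M 4 {S \<in> C. card S = 4}"
    and d: "distinct [b1,b2,b3,b4,c1,c2,c3]" and ground: "ground M = {b1,b2,b3,b4,c1,c2,c3}"
    and B: "\<And>S. S \<in> C \<Longrightarrow> S \<subseteq> {b1,b2,b3,b4} \<Longrightarrow> S = {}"
    and z: "insert c1 ({b1,b2,b3,b4} - {b1}) \<in> C" "insert c2 ({b1,b2,b3,b4} - {b2}) \<in> C" "insert c3 ({b1,b2,b3,b4} - {b3}) \<in> C"
  shows "matroid_iso M matroid_c"
proof -
  \<comment> \<open>\<open>b4\<close> is missed by none of the three cycles, so it takes position 6,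
    which is common to all sets in \<open>gens_c\<close>.\<close>
  let ?xs = "[c1,c2,b3,c3,b2,b1,b4]"
  have eqs: "insert c1 ({b1,b2,b3,b4} - {b1}) = {c1,b3,b2,b4}" "insert c2 ({b1,b2,b3,b4} - {b2}) = {c2,b3,b1,b4}" "insert c3 ({b1,b2,b3,b4} - {b3}) = {c3,b2,b1,b4}"
    using d by auto
  note cycles = z[unfolded eqs]
  have len: "length ?xs = 7" by simp
  have B_eq: "(!) ?xs ` {2,4,5,6} = {b1,b2,b3,b4}" by auto
  show ?thesis
  proof (rule matroid_iso_of_enumeration[OF sp sparse_paving_c, where xs = ?xs and B = "{2,4,5,6}"])
    show "distinct ?xs" using d by auto
    show "set ?xs = ground M" unfolding ground by auto
    show "S = {}" if "S \<in> C" "S \<subseteq> (!) ?xs ` {2,4,5,6}" for S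
      using B that unfolding B_eq .
    show "\<forall>g\<in>snd ` set gens_c. (!) ?xs ` g \<in> C" using cycles by simp
  qed (unfold len, (rule ground_exceptional reps_c | simp)+)
qed

lemma matroid_iso_d:
  assumes sp: "sparse_paving M 4 {S \<in> C. card S = 4}"
    and d: "distinct [b1,b2,b3,b4,c1,c2,c3,c4]" and ground: "ground M = {b1,b2,b3,b4,c1,c2,c3,c4}"
    and B: "\<And>S. S \<in> C \<Longrightarrow> S \<subseteq> {b1,b2,b3,b4} \<Longrightarrow> S = {}"
    and z: "insert c1 ({b1,b2,b3,b4} - {b1}) \<in> C" "insert c2 ({b1,b2,b3,b4} - {b2}) \<in> C" "insert c3 ({b1,b2,b3,b4} - {b3}) \<in> C" "insert c4 ({b1,b2,b3,b4} - {b4}) \<in> C"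
  shows "matroid_iso M matroid_d"
proof -
  let ?xs = "[b2,b3,b4,b1,c1,c2,c3,c4]"
  have eqs: "insert c1 ({b1,b2,b3,b4} - {b1}) = {b2,b3,b4,c1}" "insert c2 ({b1,b2,b3,b4} - {b2}) = {b3,b4,b1,c2}" "insert c3 ({b1,b2,b3,b4} - {b3}) = {b2,b4,b1,c3}" "insert c4 ({b1,b2,b3,b4} - {b4}) = {b2,b3,b1,c4}"
    using d by auto
  note cycles = z[unfolded eqs]
  have len: "length ?xs = 8" by simp
  have B_eq: "(!) ?xs ` {0,1,2,3} = {b1,b2,b3,b4}" by auto
  show ?thesis
  proof (rule matroid_iso_of_enumeration[OF sp sparse_paving_d, where xs = ?xs and B = "{0,1,2,3}"])
    show "distinct ?xs" using d by auto
    show "set ?xs = ground M" unfolding ground by auto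
    show "S = {}" if "S \<in> C" "S \<subseteq> (!) ?xs ` {0,1,2,3}" for S
      using B that unfolding B_eq .
    show "\<forall>g\<in>snd ` set gens_d. (!) ?xs ` g \<in> C" using cycles by simp
  qed (unfold len, (rule ground_exceptional reps_d | simp)+)
qed

end

section \<open>The classification\<close>

text \<open>\<open>z c\<close> is the part of \<open>B\<close> missed by the fundamental cycle of
  \<open>c\<close>; the girth leaves room for at most one element. In the sum of two such cycles
  only \<open>c\<close>, \<open>c'\<close> and the difference of the missed parts survive.\<close>

lemma (in binary_matroid_cycles) fundamental_cycle_structure:
  assumes girth: "\<And>S. S \<in> C \<Longrightarrow> S \<noteq> {} \<Longrightarrow> k \<le> card S"
    and B: "B \<subseteq> ground M" "rk M B = k" "card B = k" and k: "k = rk M (ground M)" "3 \<le> k"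
  obtains z where "\<And>c. c \<in> ground M - B \<Longrightarrow> z c \<subseteq> B \<and> card (z c) \<le> 1 \<and> insert c (B - z c) \<in> C"
    and "\<And>c c'. c \<in> ground M - B \<Longrightarrow> c' \<in> ground M - B \<Longrightarrow> c \<noteq> c' \<Longrightarrow>
      k \<le> 2 + card (sym_diff (z c) (z c'))"
proof -
  note finB = finite_subset_ground[OF B(1)]
  have "\<exists>z. z \<subseteq> B \<and> card z \<le> 1 \<and> insert c (B - z) \<in> C" if c: "c \<in> ground M - B" for c
  proof -
    obtain S where S: "S \<in> C" "c \<in> S" "S \<subseteq> insert c B"
      using fundamental_cycle[OF B(1) _ c] B(2) k(1) by auto
    have eq: "insert c (B - (B - S)) = S" using S by blast
    have "card S = card (insert c (B \<inter> S))" by (rule arg_cong[where f = card]) (use S in blast)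
    also have "\<dots> = card (B \<inter> S) + 1" using c finB by simp
    finally have "k \<le> card (B \<inter> S) + 1" using girth[of S] S by auto
    moreover have "card B = card (B \<inter> S) + card (B - S)" using finB by (rule card_Int_Diff)
    ultimately have "card (B - S) \<le> 1" using B(3) by linarith
    moreover have "insert c (B - (B - S)) \<in> C" unfolding eq by (rule S(1))
    ultimately show ?thesis by (intro exI[of _ "B - S"]) simp
  qed
  then have "\<forall>c\<in>ground M - B. \<exists>z. z \<subseteq> B \<and> card z \<le> 1 \<and> insert c (B - z) \<in> C" by blast
  then obtain z where z: "\<forall>c\<in>ground M - B. z c \<subseteq> B \<and> card (z c) \<le> 1 \<and> insert c (B - z c) \<in> C"
    by (rule bchoice[THEN exE])
  have "k \<le> 2 + card (sym_diff (z c) (z c'))"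
    if c: "c \<in> ground M - B" and c': "c' \<in> ground M - B" and "c \<noteq> c'" for c c'
  proof -
    let ?D = "sym_diff (insert c (B - z c)) (insert c' (B - z c'))"
    have "?D \<in> C" using z c c' by (intro sym_diff_cycle) auto
    moreover have D: "?D = {c, c'} \<union> sym_diff (z c) (z c')"
      using bspec[OF z c] bspec[OF z c'] c c' \<open>c \<noteq> c'\<close> by blast
    ultimately have "k \<le> card ({c, c'} \<union> sym_diff (z c) (z c'))" using girth by force
    also have "\<dots> \<le> card {c, c'} + card (sym_diff (z c) (z c'))" by (rule card_Un_le)
    finally show ?thesis using \<open>c \<noteq> c'\<close> by simp
  qed
  then show thesis using z that by blast
qed

theorem (in flat_chain_free) classification:
  assumes Z: "Z \<in> cyclic_flats M" "Z \<noteq> {}" "Z \<noteq> ground M"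
    and null: "rk M (ground M) + 3 \<le> card (ground M)"
  shows "matroid_iso M matroid_a \<or> matroid_iso M matroid_b \<or> matroid_iso M matroid_c \<or> matroid_iso M matroid_d"
proof -
  define k where "k = rk M (ground M)"
  have k3: "3 \<le> k" unfolding k_def by (rule rank_ge_three[OF Z])
  have girth: "k \<le> card S" if "S \<in> C" "S \<noteq> {}" for S
    unfolding k_def using rank_le_cycle[OF null] that .
  have sp: "sparse_paving M k {S \<in> C. card S = k}"
    using girth k3 null by (intro sparse_paving_of_girth) (simp_all add: k_def)
  have "rk M {} = card ({} :: 'a set)" using rk_le_card[of "{}"] by simp
  then obtain B where B: "B \<subseteq> ground M" "rk M B = card B" "card B = k"
    using basis_extension[of "{}" "ground M"] unfolding k_def by auto
  note finB = finite_subset_ground[OF B(1)]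
  have indep: "S = {}" if "S \<in> C" "S \<subseteq> B" for S
    using indep_iff[OF B(1)] B(2) that by blast
  define R where "R = ground M - B"
  have finR: "finite R" using finite_ground by (simp add: R_def)
  have ground: "ground M = B \<union> R" using B(1) by (auto simp: R_def)
  have BR: "B \<inter> R = {}" by (auto simp: R_def)
  have cardR: "3 \<le> card R"
    using null card_Diff_subset[OF finB B(1)] B(3) unfolding R_def k_def by linarith
  obtain z where z: "\<And>c. c \<in> R \<Longrightarrow> z c \<subseteq> B \<and> card (z c) \<le> 1 \<and> insert c (B - z c) \<in> C"
    and zz: "\<And>c c'. c \<in> R \<Longrightarrow> c' \<in> R \<Longrightarrow> c \<noteq> c' \<Longrightarrow> k \<le> 2 + card (sym_diff (z c) (z c'))"
    using fundamental_cycle_structure[OF girth B(1) _ B(3) k_def k3] B unfolding R_def by metis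
  \<comment> \<open>Equal missed parts would give a cycle with only two elements.\<close>
  have z_inj: "z c \<noteq> z c'" if "c \<in> R" "c' \<in> R" "c \<noteq> c'" for c c'
    using zz[OF that] k3 by auto
  \<comment> \<open>The missed parts of two elements differ in at most two elements.\<close>
  have k4: "k \<le> 4"
  proof -
    obtain c c' where c: "c \<in> R" "c' \<in> R" "c \<noteq> c'"
      using two_le_card_obtain[of R] cardR by auto
    have "finite (z c)" "finite (z c')" using z c finB finite_subset by blast+
    then have "card (sym_diff (z c) (z c')) \<le> card (z c) + card (z c')"
      by (meson add_mono card_Un_le card_mono Diff_subset order_trans)
    then show ?thesis using zz[OF c] z[OF c(1)] z[OF c(2)] by linarith
  qed
  \<comment> \<open>\<open>R0\<close> collects the elements whose fundamental cycle misses a basis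
    element, and \<open>b c\<close> is that element; \<open>b\<close> is meaningful on
    \<open>R0\<close> only. Since \<open>z\<close> is injective, at most one element of
    \<open>R\<close> is outside \<open>R0\<close>.\<close>
  define R0 where "R0 = {c \<in> R. z c \<noteq> {}}"
  define b where "b c = (THE b. z c = {b})" for c
  have b: "z c = {b c}" if "c \<in> R0" for c
  proof -
    have "finite (z c)" using z[of c] that finB finite_subset by (auto simp: R0_def)
    then have "card (z c) = 1" using z[of c] that by (auto simp: R0_def le_Suc_eq)
    then obtain y where "z c = {y}" by (rule card_1_singletonE)
    then show ?thesis by (simp add: b_def)
  qed
  have R0: "c \<in> R" "b c \<in> B" "insert c (B - {b c}) \<in> C" if "c \<in> R0" for c
    using z[of c] b[OF that] that by (auto simp: R0_def)
  have b_inj: "b c \<noteq> b c'" if "c \<in> R0" "c' \<in> R0" "c \<noteq> c'" for c c'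
    using z_inj[of c c'] R0(1) b that by force
  have finR0: "finite R0" using finR by (simp add: R0_def)
  have cardR0: "card R0 \<le> k"
    using b_inj R0(2) finB B(3) by (metis card_inj_on_le image_subsetI inj_onI)
  \<comment> \<open>Names three elements of \<open>R0\<close> with their missed basis elements;
    stated as an elimination rule because three of the cases below use it.\<close>
  have pick3: thesis
    if "card R0 = 3" and "\<And>c1 c2 c3. R0 = {c1,c2,c3} \<Longrightarrow> distinct [c1,c2,c3,b c1,b c2,b c3] \<Longrightarrow>
      {b c1,b c2,b c3} \<subseteq> B \<Longrightarrow> c1 \<in> R0 \<and> c2 \<in> R0 \<and> c3 \<in> R0 \<Longrightarrow> thesis" for thesis
  proof -
    obtain c1 c2 c3 where c: "R0 = {c1,c2,c3}" "c1 \<noteq> c2" "c1 \<noteq> c3" "c2 \<noteq> c3"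
      using \<open>card R0 = 3\<close> unfolding card_3_iff by blast
    have m: "c1 \<in> R0" "c2 \<in> R0" "c3 \<in> R0" using c(1) by auto
    have "R0 \<inter> B = {}" using R0(1) BR by blast
    moreover have "b c1 \<in> B" "b c2 \<in> B" "b c3 \<in> B" using m R0(2) by blast+
    moreover have "b c1 \<noteq> b c2" "b c1 \<noteq> b c3" "b c2 \<noteq> b c3" using m c b_inj by blast+
    ultimately have "distinct [c1,c2,c3,b c1,b c2,b c3]" using m c by auto
    then show thesis using that(2) c(1) m R0(2) by blast
  qed
  consider "k = 3" | "k = 4" using k3 k4 by linarith
  then show ?thesis
  proof cases
    case 1
    note sp = sp[unfolded 1]
    show ?thesis
    \<comment> \<open>For rank 3 it remains to decide whether some fundamental cycle contains the
      whole basis.\<close>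
    proof (cases "R0 = R")
      case True
      then have "card R0 = 3" using cardR cardR0 1 by simp
      then show ?thesis
      proof (rule pick3)
        fix c1 c2 c3
        assume c: "R0 = {c1,c2,c3}" "distinct [c1,c2,c3,b c1,b c2,b c3]" "{b c1,b c2,b c3} \<subseteq> B"
          "c1 \<in> R0 \<and> c2 \<in> R0 \<and> c3 \<in> R0"
        have BB: "B = {b c1,b c2,b c3}"
          using card_subset_eq[OF finB c(3)] c(2) B(3) 1 by simp
        have "matroid_iso M matroid_a"
        proof (rule matroid_iso_a'[OF sp])
          show "distinct [b c1, b c2, b c3, c1, c2, c3]" using c(2) by auto
          show "ground M = {b c1, b c2, b c3, c1, c2, c3}"
            unfolding ground True[symmetric] c(1) BB by blast
        qed (use indep R0(3) c(4) in \<open>simp_all only: BB[symmetric]\<close>)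
        then show ?thesis by blast
      qed
    next
      case False
      then obtain c0 where c0: "c0 \<in> R" "z c0 = {}" by (auto simp: R0_def)
      have "z c \<noteq> {}" if "c \<in> R" "c \<noteq> c0" for c using z_inj[OF that(1) c0(1) that(2)] c0(2) by simp
      then have R: "R = insert c0 R0" "c0 \<notin> R0" using c0 by (auto simp: R0_def)
      have c0_cycle: "insert c0 B \<in> C" using z[OF c0(1)] c0(2) by simp
      have c0B: "c0 \<notin> B" using c0 BR by blast
      have "card R = card R0 + 1" using R finR0 by simp
      then consider "card R0 = 2" | "card R0 = 3" using cardR cardR0 1 by linarith
      then show ?thesis
      proof cases
        case 1
        then obtain c1 c2 where c: "R0 = {c1,c2}" "c1 \<noteq> c2" unfolding card_2_iff by blast
        have m: "c1 \<in> R0" "c2 \<in> R0" using c(1) by auto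
        have bb: "b c1 \<in> B" "b c2 \<in> B" "b c1 \<noteq> b c2" using m c b_inj R0(2) by blast+
        have "card (B - {b c1, b c2}) = 1"
          using card_Diff_subset[of "{b c1, b c2}" B] bb B(3) \<open>k = 3\<close> by simp
        \<comment> \<open>\<open>b3\<close> is the basis element that no fundamental cycle
          misses.\<close>
        then obtain b3 where b3: "B - {b c1, b c2} = {b3}" by (rule card_1_singletonE)
        have BB: "B = {b c1, b c2, b3}" using b3 bb by blast
        have nB: "c1 \<notin> B" "c2 \<notin> B" using m R0(1) BR by blast+
        have "matroid_iso M matroid_a"
        proof (rule matroid_iso_a[OF sp])
          have "b3 \<in> B" "b3 \<noteq> b c1" "b3 \<noteq> b c2" using b3 by auto
          then show "distinct [b c1, b c2, b3, c0, c1, c2]"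
            using c bb nB c0B R(2) by auto
          show "ground M = {b c1, b c2, b3, c0, c1, c2}"
            unfolding ground R(1) c(1) BB by blast
        qed (use indep R0(3) m c0_cycle in \<open>simp_all only: BB[symmetric]\<close>)
        then show ?thesis by blast
      next
        case 2
        then show ?thesis
        proof (rule pick3)
          fix c1 c2 c3
          assume c: "R0 = {c1,c2,c3}" "distinct [c1,c2,c3,b c1,b c2,b c3]" "{b c1,b c2,b c3} \<subseteq> B"
            "c1 \<in> R0 \<and> c2 \<in> R0 \<and> c3 \<in> R0"
          have BB: "B = {b c1,b c2,b c3}"
            using card_subset_eq[OF finB c(3)] c(2) B(3) \<open>k = 3\<close> by simp
          have "matroid_iso M matroid_b"
          proof (rule matroid_iso_b[OF sp])
            show "distinct [b c1, b c2, b c3, c0, c1, c2, c3]"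
              using c c0B R(2) by auto
            show "ground M = {b c1, b c2, b c3, c0, c1, c2, c3}"
              unfolding ground R(1) c(1) BB by blast
          qed (use indep R0(3) c(4) c0_cycle in \<open>simp_all only: BB[symmetric]\<close>)
          then show ?thesis by blast
        qed
      qed
    qed
  next
    case 2
    note sp = sp[unfolded 2]
    \<comment> \<open>For rank 4 two missed parts must differ in two elements, so none of them is
      empty.\<close>
    have "c \<in> R0" if c: "c \<in> R" for c
    proof (rule ccontr)
      assume "c \<notin> R0"
      then have "z c = {}" using c by (simp add: R0_def)
      have "2 \<le> card R" using cardR by simp
      then obtain d d' where "d \<in> R" "d' \<in> R" "d \<noteq> d'" by (rule two_le_card_obtain)
      then obtain c' where c': "c' \<in> R" "c' \<noteq> c" by blast
      have "k \<le> 2 + card (z c')" using zz[OF c c'(1)] c'(2) \<open>z c = {}\<close> by simp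
      then show False using z[OF c'(1)] 2 by linarith
    qed
    then have RR: "R = R0" by (auto simp: R0_def)
    consider "card R0 = 3" | "card R0 = 4" using cardR[unfolded RR] cardR0 2 by linarith
    then show ?thesis
    proof cases
      case 1
      then show ?thesis
      proof (rule pick3)
        fix c1 c2 c3
        assume c: "R0 = {c1,c2,c3}" "distinct [c1,c2,c3,b c1,b c2,b c3]" "{b c1,b c2,b c3} \<subseteq> B"
          "c1 \<in> R0 \<and> c2 \<in> R0 \<and> c3 \<in> R0"
        have "card (B - {b c1,b c2,b c3}) = 1"
          using card_Diff_subset[of "{b c1,b c2,b c3}" B] c(2,3) B(3) \<open>k = 4\<close> by simp
        \<comment> \<open>The one basis element common to all three fundamental cycles.\<close>
        then obtain b4 where b4: "B - {b c1,b c2,b c3} = {b4}" by (rule card_1_singletonE)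
        have BB: "B = {b c1,b c2,b c3,b4}" using b4 c(3) by blast
        have "matroid_iso M matroid_c"
        proof (rule matroid_iso_c[OF sp])
          have "b4 \<in> B" "b4 \<notin> {b c1,b c2,b c3}" using b4 by auto
          moreover have "R0 \<inter> B = {}" using BR RR by blast
          ultimately show "distinct [b c1, b c2, b c3, b4, c1, c2, c3]" using c by auto
          show "ground M = {b c1, b c2, b c3, b4, c1, c2, c3}"
            unfolding ground RR c(1) BB by blast
        qed (use indep R0(3) c(4) in \<open>simp_all only: BB[symmetric]\<close>)
        then show ?thesis by blast
      qed
    next
      case 2
      then obtain c1 R' where R': "R0 = insert c1 R'" "c1 \<notin> R'" "card R' = 3"
        using card_eq_SucD[of R0 3] by auto
      obtain c2 c3 c4 where c: "R' = {c2,c3,c4}" "c2 \<noteq> c3" "c2 \<noteq> c4" "c3 \<noteq> c4"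
        using R'(3) unfolding card_3_iff by blast
      have R0_eq: "R0 = {c1,c2,c3,c4}" and dc: "distinct [c1,c2,c3,c4]" using R' c by auto
      have m: "c1 \<in> R0" "c2 \<in> R0" "c3 \<in> R0" "c4 \<in> R0" using R0_eq by auto
      have bB: "{b c1,b c2,b c3,b c4} \<subseteq> B" using m R0(2) by blast
      have db: "distinct [b c1,b c2,b c3,b c4]" using dc m b_inj by auto
      have BB: "B = {b c1,b c2,b c3,b c4}"
        using card_subset_eq[OF finB bB] db B(3) \<open>k = 4\<close> by simp
      have "matroid_iso M matroid_d"
      proof (rule matroid_iso_d[OF sp])
        have "R0 \<inter> B = {}" using BR RR by blast
        then show "distinct [b c1, b c2, b c3, b c4, c1, c2, c3, c4]"
          using dc db m bB by auto
        show "ground M = {b c1, b c2, b c3, b c4, c1, c2, c3, c4}"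
          unfolding ground RR R0_eq BB by blast
      qed (use indep R0(3) m in \<open>simp_all only: BB[symmetric]\<close>)
      then show ?thesis by blast
    qed
  qed
qed

section \<open>Translating height, simplicity and representability into properties of cycles\<close>

lemma cyclic_flats_finite:
  assumes "finite (ground M)"
  shows "finite (cyclic_flats M)"
  by (rule finite_subset[of _ "Pow (ground M)"]) (use assms in \<open>auto simp: cyclic_flats_def\<close>)

lemma finite_chain_cards:
  assumes "finite L"
  shows "finite {card D | D. subset.chain L D}"
proof -
  have "{card D | D. subset.chain L D} \<subseteq> card ` Pow L"
    by (auto simp: subset_chain_def)
  then show ?thesis using assms finite_subset by blast
qed

lemma card_chain_le_height:
  assumes "finite L" "subset.chain L D"
  shows "card D \<le> height L"
  unfolding height_def using finite_chain_cards[OF assms(1)] assms(2) by (intro Max_ge) auto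

lemma height_obtain_chain:
  assumes "finite L"
  obtains D where "subset.chain L D" "card D = height L"
proof -
  have "subset.chain L {}" by (simp add: subset_chain_def)
  then have "{card D | D. subset.chain L D} \<noteq> {}" by blast
  then have "height L \<in> {card D | D. subset.chain L D}"
    unfolding height_def using finite_chain_cards[OF assms] by (rule Max_in[rotated])
  then show thesis using that by auto
qed

text \<open>A cycle with one element would be a loop, and one with two elements a parallel
  pair.\<close>

lemma simple_cycle_card:
  assumes "binary_cycles M C" and simple: "simple_matroid M" and S: "S \<in> C" "S \<noteq> {}"
  shows "3 \<le> card S"
proof (rule ccontr)
  interpret binary_cycles M C by fact
  assume "\<not> 3 \<le> card S"
  have sub: "S \<subseteq> ground M" using S cycle_subset by blast
  have "0 < card S" using S finite_subset_ground[OF sub] by (simp add: card_gt_0_iff)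
  then consider "card S = 1" | "card S = 2" using \<open>\<not> 3 \<le> card S\<close> by linarith
  moreover have dep: "rk M S < card S"
    using indep_iff[OF sub] S rk_le_card[OF sub] by fastforce
  have loopless: "rk M {e} = 1" if "e \<in> ground M" for e
  proof -
    have "rk M {e} \<noteq> 0" using simple that by (auto simp: simple_matroid_def loop_def)
    moreover have "rk M {e} \<le> 1" using rk_le_card[of "{e}"] that by simp
    ultimately show ?thesis by simp
  qed
  ultimately show False
  proof cases
    case 1
    then obtain e where "S = {e}" by (rule card_1_singletonE)
    then show False using loopless[of e] dep sub by simp
  next
    case 2
    then obtain e f where ef: "S = {e, f}" "e \<noteq> f" unfolding card_2_iff by blast
    have mem: "e \<in> ground M" "f \<in> ground M" using ef sub by auto
    have "rk M {e} \<le> rk M S" using ef sub by (intro rk_mono) auto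
    then have "rk M {e, f} = 1" using dep 2 loopless[OF mem(1)] unfolding ef(1) by simp
    then have "parallel_elements M e f"
      using mem ef(2) loopless by (simp add: parallel_elements_def loop_def)
    then show False using simple by (simp add: simple_matroid_def)
  qed
qed

lemma empty_cyclic_flat:
  assumes "simple_matroid M"
  shows "{} \<in> cyclic_flats M"
proof -
  have "rk M {} \<le> card ({} :: 'a set)"
    using assms unfolding simple_matroid_def matroid_def by blast
  then have "rk M {} = 0" by simp
  moreover have "rk M {e} \<noteq> 0" if "e \<in> ground M" for e
    using assms that by (auto simp: simple_matroid_def loop_def)
  ultimately show ?thesis by (auto simp: cyclic_flats_def cl_def cyc_def)
qed

lemma ground_cyclic_flat:
  assumes M: "matroid M" and "\<forall>e. \<not> isthmus M e"
  shows "rk M (ground M - {e}) = rk M (ground M)" "ground M \<in> cyclic_flats M"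
proof -
  show *: "rk M (ground M - {e}) = rk M (ground M)" for e
  proof (cases "e \<in> ground M")
    case True
    have "\<forall>X Y. X \<subseteq> Y \<and> Y \<subseteq> ground M \<longrightarrow> rk M X \<le> rk M Y"
      using M unfolding matroid_def by (elim conjE)
    then have "rk M (ground M - {e}) \<le> rk M (ground M)" by simp
    moreover have "\<not> rk M (ground M - {e}) < rk M (ground M)"
      using spec[OF assms(2), of e] True unfolding isthmus_def by simp
    ultimately show ?thesis by simp
  qed simp
  then show "ground M \<in> cyclic_flats M"
    by (auto simp: cyclic_flats_def cl_def cyc_def insert_absorb)
qed

text \<open>The cycles are pulled back from a representing matrix, while submodularity is taken from
  \<open>M\<close> itself.\<close>

lemma binary_matroid_obtain_cycles:
  assumes "binary_matroid M"
  obtains C where "binary_matroid_cycles M C"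
proof -
  have M: "matroid M" using assms by (simp add: binary_matroid_def)
  obtain A :: "bit mat" where "matroid_iso M (column_matroid A)"
    using assms unfolding binary_matroid_def representable_over_def by blast
  then obtain f where f: "bij_betw f (ground M) (ground (column_matroid A))"
    and rk: "\<And>X. X \<subseteq> ground M \<Longrightarrow> rk (column_matroid A) (f ` X) = rk M X"
    unfolding matroid_iso_def by blast
  have "binary_cycles M {S. S \<subseteq> ground M \<and> f ` S \<in> zero_sums A}"
    by (rule binary_cycles.binary_cycles_pullback[OF binary_cycles_column_matroid f rk])
  then have "binary_matroid_cycles M {S. S \<subseteq> ground M \<and> f ` S \<in> zero_sums A}"
    using M unfolding binary_matroid_cycles_def binary_matroid_cycles_axioms_def matroid_def by blast
  then show thesis by (rule that)
qed

theorem theorem8p10: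
  fixes M :: "'a rank_space" and n k d :: nat
  assumes "binary_matroid M"
    and "simple_matroid M"
    and "nkd_matroid M n k d"
    and "\<forall>e. \<not> isthmus M e"
    and "height (cyclic_flats M) = 3"
  shows "(nullity M (ground M) = 2
            \<or> matroid_iso M matroid_a \<or> matroid_iso M matroid_b
            \<or> matroid_iso M matroid_c \<or> matroid_iso M matroid_d)
         \<and> nkd_matroid matroid_a 6 3 3 \<and> card (atoms (cyclic_flats matroid_a)) = 4
         \<and> nkd_matroid matroid_b 7 3 4 \<and> card (atoms (cyclic_flats matroid_b)) = 7
         \<and> nkd_matroid matroid_c 7 4 3 \<and> card (atoms (cyclic_flats matroid_c)) = 7
         \<and> nkd_matroid matroid_d 8 4 4 \<and> card (atoms (cyclic_flats matroid_d)) = 14"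
proof -
  have M: "matroid M" using assms(1) by (simp add: binary_matroid_def)
  obtain C where "binary_matroid_cycles M C"
    using binary_matroid_obtain_cycles[OF assms(1)] .
  then interpret binary_matroid_cycles M C .
  note flats = empty_cyclic_flat[OF assms(2)] ground_cyclic_flat(2)[OF M assms(4)]
  have fin: "finite (cyclic_flats M)" by (rule cyclic_flats_finite[OF finite_ground])
  have sub: "X \<subseteq> ground M" if "X \<in> cyclic_flats M" for X
    using that by (simp add: cyclic_flats_def)
  interpret flat_chain_free M C
  proof
    show "3 \<le> card S" if "S \<in> C" "S \<noteq> {}" for S
      by (rule simple_cycle_card[OF binary_cycles_axioms assms(2) that])
    show "rk M (ground M - {e}) = rk M (ground M)" for e
      by (rule ground_cyclic_flat(1)[OF M assms(4)])
    \<comment> \<open>Otherwise the empty set, \<open>A\<close>, \<open>B\<close> and the ground set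
      would form a chain of four cyclic flats.\<close>
    show "B = ground M"
      if A: "A \<in> cyclic_flats M" and B: "B \<in> cyclic_flats M" and "A \<noteq> {}" "A \<subset> B" for A B
    proof (rule ccontr)
      assume "B \<noteq> ground M"
      then have "B \<subset> ground M" using sub[OF B] by blast
      have "subset.chain (cyclic_flats M) {{}, A, B, ground M}"
        using A B flats \<open>A \<subset> B\<close> \<open>B \<subset> ground M\<close> by (auto simp: subset_chain_def)
      then have "card {{}, A, B, ground M} \<le> 3"
        using card_chain_le_height[OF fin] assms(5) by metis
      moreover have "{} \<noteq> A" "{} \<noteq> B" "{} \<noteq> ground M" "A \<noteq> B" "A \<noteq> ground M" "B \<noteq> ground M"
        using \<open>A \<noteq> {}\<close> \<open>A \<subset> B\<close> \<open>B \<subset> ground M\<close> by blast+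
      ultimately show False by simp
    qed
  qed
  obtain D where D: "subset.chain (cyclic_flats M) D" "card D = 3"
    using height_obtain_chain[OF fin] assms(5) by metis
  \<comment> \<open>A chain with three elements must contain a cyclic flat other than the empty set
    and the ground set.\<close>
  have "\<not> D \<subseteq> {{}, ground M}"
  proof
    assume "D \<subseteq> {{}, ground M}"
    then have "card D \<le> card {{}, ground M}" by (intro card_mono) auto
    also have "\<dots> \<le> 2" by (simp add: card_insert_if)
    finally show False using D(2) by simp
  qed
  then obtain Z where Z: "Z \<in> cyclic_flats M" "Z \<noteq> {}" "Z \<noteq> ground M"
    using D(1) unfolding subset_chain_def by blast
  \<comment> \<open>Such a flat forces nullity at least 2, so the alternative to 2 is at least
    3.\<close>
  have "nullity M (ground M) = 2 \<or> rk M (ground M) + 3 \<le> card (ground M)"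
    using nullity_ge_two[OF Z] unfolding nullity_def by linarith
  then have "nullity M (ground M) = 2
      \<or> matroid_iso M matroid_a \<or> matroid_iso M matroid_b
      \<or> matroid_iso M matroid_c \<or> matroid_iso M matroid_d"
    using classification[OF Z] by blast
  then show ?thesis
    using exceptional_parameters[OF sparse_paving_a ground_exceptional(1) card_hyperplanes(1)]
      exceptional_parameters[OF sparse_paving_b ground_exceptional(2) card_hyperplanes(2)]
      exceptional_parameters[OF sparse_paving_c ground_exceptional(3) card_hyperplanes(3)]
      exceptional_parameters[OF sparse_paving_d ground_exceptional(4) card_hyperplanes(4)]
    by simp
qed

end
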